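(* Let $\mathrm{Cvx}_0(\mathbb{R}^n)$ be the set of non-negative even convex functions $f:\mathbb{R}^n\to[0,\infty)$ with $f(0)=0$. For every $f\in\mathrm{Cvx}_0(\mathbb{R}^n)$, with $f_*$ its spherically symmetric increasing rearrangement, $$|\{f^\circ\le\lambda\}|\ \le\ |\{(f_* )^\circ\le\lambda\}|\qquad\text{for all }\lambda\in\mathbb{R},$$ where $g^\circ$ denotes the polar transform of $g$.
   Context: $|\cdot|$ is Lebesgue measure on $\mathbb{R}^n$ and $\langle\cdot,\cdot\rangle$ the Euclidean scalar product. Polar transform: for a Borel measurable convex $f:\mathbb{R}^n\to[0,\infty)$ with $f(0)=0$, $$f^\circ(x)=\sup_{y\in\mathbb{R}^n}\frac{\langle x,y\rangle-1}{f(y)}\in[0,+\infty]$$ if $f$ is not identically zero, and $0^\circ=0$ for the zero function. Conventions: $\frac{0}{0}=0$, and a positive number divided by $0$ equals $+\infty$ (a negative number divided by $0$ equals $-\infty$). Rearrangement: for a Borel set $A\subseteq\mathbb{R}^n$, $A^*=\{x:\|x\|<r\}$ is the open Euclidean ball centered at $0$ with $|A^*|=|A|$ (so $A^*=\emptyset$ if $|A|=0$ and $A^*=\mathbb{R}^n$ if $|A|=\infty$). For measurable $g\ge0$, $g^*(y)=\int_0^\infty\mathbf{1}_{\{g>s\}^*}(y)\,ds$. The spherically symmetric increasing rearrangement of a measurable $f:\mathbb{R}^n\to\mathbb{R}$ is $f_*=-\log\big((e^{-f})^*\big)$; it satisfies $\{f_*<\lambda\}=\{f<\lambda\}^*$ for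 all $\lambda\in\mathbb{R}$. *)

theory Defs
  imports "HOL-Analysis.Analysis"
begin

definition Cvx0 :: "('a::euclidean_space \<Rightarrow> real) set" where
  "Cvx0 = {f. convex_on UNIV f \<and> (\<forall>x. 0 \<le> f x) \<and> (\<forall>x. f (- x) = f x) \<and> f 0 = 0}"

(* Division on ereal already obeys the conventions used for the polar transform. *)
lemma ereal_quotient_conventions:
  "(0::ereal) / 0 = 0"
  "0 < a \<Longrightarrow> ereal a / 0 = \<infinity>"
  "a < 0 \<Longrightarrow> ereal a / 0 = - \<infinity>"
  "b \<noteq> 0 \<Longrightarrow> ereal a / ereal b = ereal (a / b)"
  by (auto simp: divide_ereal_def divide_inverse)

definition polar :: "('a::euclidean_space \<Rightarrow> real) \<Rightarrow> 'a \<Rightarrow> ereal" where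
  "polar f x = (if f = (\<lambda>_. 0) then 0 else (SUP y. ereal (x \<bullet> y - 1) / ereal (f y)))"

lemma ball_radius_unique:
  assumes "m \<noteq> (\<infinity>::ennreal)"
  shows "\<exists>!r. 0 \<le> r \<and> emeasure lebesgue (ball (0::'a::euclidean_space) r) = m"
proof -
  define c where "c = unit_ball_vol (real DIM('a))"
  have c: "c > 0" by (simp add: c_def)
  have vol: "emeasure lebesgue (ball (0::'a) r) = ennreal (c * r ^ DIM('a))" if "0 \<le> r" for r
    using emeasure_ball[OF that, of "0::'a"] by (simp add: c_def)
  obtain m' where m': "m = ennreal m'" "0 \<le> m'"
    using assms by (cases m) (auto simp: infinity_ennreal_def)
  show ?thesis
  proof (rule ex1I[of _ "root DIM('a) (m' / c)"])
    show "0 \<le> root DIM('a) (m' / c) \<and>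
        emeasure lebesgue (ball (0::'a) (root DIM('a) (m' / c))) = m"
      using m' c vol[of "root DIM('a) (m' / c)"] by simp
  next
    fix r :: real
    assume r: "0 \<le> r \<and> emeasure lebesgue (ball (0::'a) r) = m"
    then have "c * r ^ DIM('a) = m'"
      using c m' vol[of r] by simp
    then have "r ^ DIM('a) = m' / c"
      using c by (simp add: field_simps)
    then show "r = root DIM('a) (m' / c)"
      using r by (metis real_root_power_cancel DIM_positive)
  qed
qed

definition set_rearr :: "'a::euclidean_space set \<Rightarrow> 'a set" where
  "set_rearr A =
     (if emeasure lebesgue A = \<infinity> then UNIV
      else ball 0 (THE r. 0 \<le> r \<and> emeasure lebesgue (ball (0::'a) r) = emeasure lebesgue A))"

lemma set_rearr_ball:
  fixes A :: "'a::euclidean_space set"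
  assumes "emeasure lebesgue A \<noteq> \<infinity>"
  obtains r where "0 \<le> r" "set_rearr A = ball 0 r"
    "emeasure lebesgue (ball (0::'a) r) = emeasure lebesgue A"
  using theI'[OF ball_radius_unique[OF assms, where 'a='a]] assms
  by (auto simp: set_rearr_def)

lemma set_rearr_empty [simp]: "set_rearr ({} :: 'a::euclidean_space set) = {}"
proof -
  obtain r where "0 \<le> r" "set_rearr ({}::'a set) = ball 0 r"
    "emeasure lebesgue (ball (0::'a) r) = emeasure lebesgue ({}::'a set)"
    by (rule set_rearr_ball[of "{}::'a set"]) auto
  then show ?thesis
    using content_ball_eq_0_iff[of "0::'a" r] by (simp add: measure_def)
qed

definition decr_rearr :: "('a::euclidean_space \<Rightarrow> real) \<Rightarrow> 'a \<Rightarrow> ennreal" where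
  "decr_rearr g y = (\<integral>\<^sup>+ s\<in>{0..}. indicator (set_rearr {x. s < g x}) y \<partial>lborel)"

definition incr_rearr :: "('a::euclidean_space \<Rightarrow> real) \<Rightarrow> 'a \<Rightarrow> real" where
  "incr_rearr f y = - ln (enn2real (decr_rearr (\<lambda>x. exp (- f x)) y))"

(* On Cvx0 the value inside the logarithm is a genuine number in (0,1], so the totalised
   conventions for enn2real at infinity and ln at 0 play no role. *)
lemma decr_rearr_exp_bounds:
  fixes f :: "'a::euclidean_space \<Rightarrow> real"
  assumes "f \<in> Cvx0"
  shows "0 < decr_rearr (\<lambda>x. exp (- f x)) y" and "decr_rearr (\<lambda>x. exp (- f x)) y \<le> 1"
proof -
  have conv: "convex_on UNIV f" and f0: "\<And>x. 0 \<le> f x"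
    using assms by (auto simp: Cvx0_def)
  have cont: "continuous_on UNIV f"
    using conv by (intro convex_on_continuous) auto
  have meas: "{x. f x < t} \<in> sets lebesgue" for t
  proof -
    have "open {x. f x < t}"
      using cont by (intro open_Collect_less) auto
    then show ?thesis by (simp add: borel_open)
  qed
  have "decr_rearr (\<lambda>x. exp (- f x)) y \<le> (\<integral>\<^sup>+ s. indicator {0..1::real} s \<partial>lborel)"
    unfolding decr_rearr_def
  proof (rule nn_integral_mono)
    fix s :: real
    have "{x. s < exp (- f x)} = {}" if "s > 1"
    proof -
      have "exp (- f x) \<le> 1" for x using f0[of x] by simp
      with that have "\<not> s < exp (- f x)" for x by (meson less_le_trans not_less order.asym)
      then show ?thesis by blast
    qed
    then show "indicator (set_rearr {x. s < exp (- f x)}) y * indicator {0..} s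
        \<le> (indicator {0..1} s :: ennreal)"
      by (cases "s > 1") (auto simp: indicator_def)
  qed
  then show "decr_rearr (\<lambda>x. exp (- f x)) y \<le> 1" by simp
  have lev: "{x. exp (- t) < exp (- f x)} = {x. f x < t}" for t by auto
  have "(\<Union>k::nat. {x. f x < real k}) = UNIV"
    using reals_Archimedean2 by auto
  then have "(\<lambda>k. emeasure lebesgue {x. f x < real k}) \<longlonglongrightarrow> emeasure lebesgue (UNIV :: 'a set)"
    using Lim_emeasure_incseq[of "\<lambda>k::nat. {x. f x < real k}" lebesgue] meas
    by (force simp: incseq_def)
  then have lim: "(\<lambda>k. emeasure lebesgue {x. f x < real k}) \<longlonglongrightarrow> (\<infinity>::ennreal)"
    by (simp add: emeasure_lborel_UNIV)
  have "emeasure lebesgue (ball (0::'a) (norm y + 1)) < \<infinity>"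
    using emeasure_lborel_ball_finite by (simp add: less_top)
  then obtain k :: nat where k: "emeasure lebesgue (ball (0::'a) (norm y + 1)) < emeasure lebesgue {x. f x < real k}"
    using order_tendstoD(1)[OF lim] by (auto simp: eventually_sequentially)
  have big: "y \<in> set_rearr {x. f x < t}" if "real k \<le> t" for t
  proof (cases "emeasure lebesgue {x. f x < t} = \<infinity>")
    case True
    then show ?thesis by (simp add: set_rearr_def)
  next
    case False
    have "emeasure lebesgue {x. f x < real k} \<le> emeasure lebesgue {x. f x < t}"
      using that meas by (intro emeasure_mono) auto
    with k have lt: "emeasure lebesgue (ball (0::'a) (norm y + 1)) < emeasure lebesgue {x. f x < t}"
      by order
    obtain r where r: "set_rearr {x. f x < t} = ball 0 r"
      "emeasure lebesgue (ball (0::'a) r) = emeasure lebesgue {x. f x < t}"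
      using False by (rule set_rearr_ball)
    have "norm y + 1 < r"
    proof (rule ccontr)
      assume "\<not> norm y + 1 < r"
      then have "emeasure lebesgue (ball (0::'a) r) \<le> emeasure lebesgue (ball (0::'a) (norm y + 1))"
        by (intro emeasure_mono) auto
      with lt r show False by simp
    qed
    then show ?thesis by (simp add: r)
  qed
  have "0 < ennreal (exp (- real k))" by simp
  also have "\<dots> = (\<integral>\<^sup>+ s. indicator {0<..exp (- real k)} s \<partial>lborel)" by simp
  also have "\<dots> \<le> decr_rearr (\<lambda>x. exp (- f x)) y"
    unfolding decr_rearr_def
  proof (rule nn_integral_mono)
    fix s :: real
    have "y \<in> set_rearr {x. s < exp (- f x)}" if "0 < s" "s \<le> exp (- real k)"
    proof -
      have "real k \<le> - ln s"
        using that by (metis exp_gt_zero ln_exp ln_le_cancel_iff minus_le_iff neg_le_iff_le)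
      from big[OF this] show ?thesis
        using lev[of "- ln s"] that by simp
    qed
    then show "(indicator {0<..exp (- real k)} s :: ennreal)
        \<le> indicator (set_rearr {x. s < exp (- f x)}) y * indicator {0..} s"
      by (auto simp: indicator_def)
  qed
  finally show "0 < decr_rearr (\<lambda>x. exp (- f x)) y" .
qed

end

theory Submission
  imports Defs
begin

text \<open>
  For \<open>t \<ge> 0\<close> and \<open>f \<noteq> 0\<close> the set \<open>{polar f \<le> t}\<close> consists of the \<open>x\<close> with
  \<open>x \<bullet> y \<le> 1 + t f(y)\<close> for all \<open>y\<close>. It is therefore the intersection over all levels \<open>s > 0\<close> of
  the dilates \<open>(1 + t s) K\<^sub>s\<close>, where \<open>K\<^sub>s\<close> is the polar of the symmetric open set \<open>{f < s}\<close>.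
  For the rearranged function the sublevel sets are centred balls of the same volumes, so the
  intersection is a ball, and its volume is the infimum of the volumes of the dilates. Hence
  everything reduces to comparing a single sublevel set with the ball of the same volume, which is
  the symmetric Blaschke--Santalo inequality (\<open>blaschke_santalo\<close>): among symmetric sets of given
  volume, the ball has the polar of largest volume.

  That inequality is proved by Steiner symmetrization. Symmetrizing \<open>A\<close> along an axis does not
  decrease the volume of its polar (\<open>emeasure_polar_set_steiner\<close>): each slice of the new polar
  orthogonal to the axis contains half the difference set of the corresponding slice of the old one,
  and the Prekopa--Leindler inequality in the form \<open>prekopa_leindler_PiM\<close> bounds the measure of
  that difference set from below.

  It remains to come close to a ball by symmetrizations. Let \<open>B\<close> be a centred ball with
  \<open>|B| \<le> |A|\<close>. Averaging over all translations shows that one of them moves a definite part of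
  \<open>A - B\<close> into \<open>B - A\<close> (\<open>exists_large_overlap\<close>), and symmetrizing in its direction increases the
  overlap with \<open>B\<close> by that part (\<open>emeasure_steiner_Int\<close>). So after finitely many symmetrizations
  the set misses arbitrarily little of \<open>B\<close> (\<open>symmetrized_approaches_ball\<close>). A set that misses less
  of \<open>B\<close> than a cap cut off by a halfspace has its polar in a slightly enlarged polar of \<open>B\<close>.
\<close>

section \<open>The Prekopa--Leindler inequality for differences\<close>

text \<open>
  The subgraph of \<open>f\<close> is measured once along vertical and once along horizontal lines. Only levels
  below 1 occur because \<open>f \<le> 1\<close>; normalizing two functions to the same supremum is what makes the
  level sets of both nonempty for the same range of levels.
\<close>
lemma nn_integral_layer_cake:
  fixes f :: "real \<Rightarrow> ennreal"
  assumes [measurable]: "f \<in> borel_measurable borel" and le1: "\<And>x. f x \<le> 1"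
  shows "(\<integral>\<^sup>+ x. f x \<partial>lborel) = (\<integral>\<^sup>+ s\<in>{0<..<1}. emeasure lborel {x. ennreal s < f x} \<partial>lborel)"
proof -
  have "(\<integral>\<^sup>+ x. f x \<partial>lborel)
      = (\<integral>\<^sup>+ x. \<integral>\<^sup>+ s. indicator {0<..<1} s * indicator {x. ennreal s < f x} x \<partial>lborel \<partial>lborel)"
  proof (rule nn_integral_cong)
    fix x
    obtain r where r: "f x = ennreal r" "0 \<le> r" "r \<le> 1"
      using le1[of x] by (cases "f x") (auto simp: top_unique)
    have "(\<integral>\<^sup>+ s. indicator {0<..<1} s * indicator {x. ennreal s < f x} x \<partial>lborel)
        = (\<integral>\<^sup>+ s. indicator {0<..<r} s \<partial>lborel)"
      using r by (intro nn_integral_cong) (auto simp: indicator_def ennreal_less_iff)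
    also have "\<dots> = f x" using r by simp
    finally show "f x = (\<integral>\<^sup>+ s. indicator {0<..<1} s * indicator {x. ennreal s < f x} x \<partial>lborel)" ..
  qed
  also have "\<dots> = (\<integral>\<^sup>+ s. \<integral>\<^sup>+ x. indicator {0<..<1} s * indicator {x. ennreal s < f x} x \<partial>lborel \<partial>lborel)"
    by (intro lborel_pair.Fubini') measurable
  also have "\<dots> = (\<integral>\<^sup>+ s\<in>{0<..<1}. emeasure lborel {x. ennreal s < f x} \<partial>lborel)"
    by (subst nn_integral_cmult) (auto intro!: nn_integral_cong simp: mult.commute)
  finally show ?thesis .
qed

text \<open>
  The one-dimensional Brunn--Minkowski inequality, for differences. With \<open>a = max A\<close> and
  \<open>b = max B\<close> the translate \<open>A - b\<close> ends at \<open>a - b\<close>, where the reflected translate \<open>a - B\<close>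
  starts; both lie in \<open>A - B\<close> and share only that one point.
\<close>
lemma compact_difference_emeasure:
  fixes A B :: "real set"
  assumes "compact A" "compact B" "A \<noteq> {}" "B \<noteq> {}"
    and "H \<in> sets lborel" and sub: "\<And>a b. a \<in> A \<Longrightarrow> b \<in> B \<Longrightarrow> a - b \<in> H"
  shows "emeasure lborel A + emeasure lborel B \<le> emeasure lborel H"
proof -
  obtain a where a: "a \<in> A" "\<And>x. x \<in> A \<Longrightarrow> x \<le> a"
    using compact_attains_sup[OF assms(1,3)] by blast
  obtain b where b: "b \<in> B" "\<And>x. x \<in> B \<Longrightarrow> x \<le> b"
    using compact_attains_sup[OF assms(2,4)] by blast
  let ?A = "(\<lambda>x. - b + x) ` A" and ?B = "(\<lambda>x. a + (-1) * x) ` B"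
  have cpt: "compact ?A" "compact ?B"
    using assms by (auto intro!: compact_continuous_image continuous_intros)
  have mA: "emeasure lborel ?A = emeasure lborel A"
    using emeasure_lebesgue_affine[of 1 "- b" A] assms(1) cpt by (simp add: borel_compact add.commute)
  have mB: "emeasure lborel ?B = emeasure lborel B"
    using emeasure_lebesgue_affine[of "-1" a B] assms(2) cpt
    by (simp add: borel_compact add.commute)
  have "?A \<inter> ?B \<subseteq> {a - b}"
    using a b by fastforce
  then have "?B - ?A \<supseteq> ?B - {a - b}" by auto
  have "emeasure lborel A + emeasure lborel B = emeasure lborel ?A + emeasure lborel ?B"
    using mA mB by simp
  also have "emeasure lborel ?B = emeasure lborel (?B - {a - b})"
    using cpt by (intro emeasure_Diff_null_set[symmetric]) (auto simp: borel_compact)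
  also have "\<dots> \<le> emeasure lborel (?B - ?A)"
    using cpt \<open>?B - ?A \<supseteq> ?B - {a - b}\<close> by (intro emeasure_mono) (auto simp: borel_compact)
  also have "emeasure lborel ?A + emeasure lborel (?B - ?A) = emeasure lborel (?A \<union> (?B - ?A))"
    using cpt by (intro plus_emeasure) (auto simp: borel_compact)
  also have "\<dots> \<le> emeasure lborel H"
    using assms(5) sub a b by (intro emeasure_mono) force+
  finally show ?thesis by (simp add: add_left_mono)
qed

text \<open>
  Inner regularity holds for finite Borel measures, so Lebesgue measure is first restricted to a
  large bounded interval.
\<close>
lemma borel_inner_compact:
  fixes A :: "real set"
  assumes "A \<in> sets borel" "c < emeasure lborel A"
  obtains K where "compact K" "K \<subseteq> A" "c < emeasure lborel K"
proof -
  have inc: "(\<lambda>n. emeasure lborel (A \<inter> {- real n..real n})) \<longlonglongrightarrow> emeasure lborel (\<Union>n. A \<inter> {- real n..real n})"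
    using assms(1) by (intro Lim_emeasure_incseq) (auto simp: incseq_def)
  have "(\<Union>n. A \<inter> {- real n..real n}) = A"
  proof -
    have "\<exists>n. - real n \<le> x \<and> x \<le> real n" for x
      using real_arch_simple[of "\<bar>x\<bar>"] by (metis abs_le_iff minus_le_iff)
    then show ?thesis by auto
  qed
  with order_tendstoD(1)[OF inc, of c] assms(2)
  obtain n where n: "c < emeasure lborel (A \<inter> {- real n..real n})"
    by (auto simp: eventually_sequentially)
  let ?A = "A \<inter> {- real n..real n}" and ?M = "density lborel (indicator {- real n..real n} :: real \<Rightarrow> ennreal)"
  have e: "emeasure ?M X = emeasure lborel (X \<inter> {- real n..real n})" if "X \<in> sets borel" for X
    using that by (subst emeasure_density) (auto intro!: nn_integral_cong simp: indicator_inter_arith[symmetric] Int_commute  simp flip: nn_integral_indicator split: split_indicator)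
  have "emeasure ?M ?A = (SUP K \<in> {K. K \<subseteq> ?A \<and> compact K}. emeasure ?M K)"
    using assms(1) by (intro inner_regular) (auto simp: e)
  moreover have "emeasure ?M ?A = emeasure lborel ?A"
    using e[of ?A] assms(1) by (simp add: Int_assoc)
  ultimately have "c < (SUP K \<in> {K. K \<subseteq> ?A \<and> compact K}. emeasure ?M K)" using n by simp
  then obtain K where "K \<subseteq> ?A" "compact K" "c < emeasure ?M K"
    unfolding less_SUP_iff by blast
  moreover have "emeasure ?M K = emeasure lborel K"
    using \<open>K \<subseteq> ?A\<close> e[of K] \<open>compact K\<close> by (simp add: borel_compact Int_absorb2)
  ultimately show thesis using that[of K] by auto
qed

text \<open>
  Reduces an estimate for a Borel set to its nonempty compact subsets. Applied to each of two sets in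
  turn, it removes compactness from the preceding inequality.
\<close>
lemma emeasure_add_le_of_compact:
  fixes A :: "real set"
  assumes A: "A \<in> sets borel" "A \<noteq> {}"
    and le: "\<And>K. \<lbrakk>compact K; K \<noteq> {}; K \<subseteq> A\<rbrakk> \<Longrightarrow> emeasure lborel K + d \<le> e"
  shows "emeasure lborel A + d \<le> e"
proof -
  let ?C = "{K. compact K \<and> K \<noteq> {} \<and> K \<subseteq> A}"
  obtain a where "a \<in> A" using A by auto
  then have ne: "?C \<noteq> {}" by (intro ex_in_conv[THEN iffD1] exI[of _ "{a}"]) auto
  have "emeasure lborel A \<le> (SUP K\<in>?C. emeasure lborel K)"
  proof (rule ccontr)
    assume "\<not> ?thesis"
    then have "(SUP K\<in>?C. emeasure lborel K) < emeasure lborel A" by simp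
    from borel_inner_compact[OF A(1) this] obtain K where K: "compact K" "K \<subseteq> A" "(SUP K\<in>?C. emeasure lborel K) < emeasure lborel K"
      by blast
    then have "K \<in> ?C" by auto
    from SUP_upper[OF this, of "emeasure lborel"] K(3) show False by simp
  qed
  then have "emeasure lborel A + d \<le> (SUP K\<in>?C. emeasure lborel K) + d"
    by (rule add_right_mono)
  also have "\<dots> = (SUP K\<in>?C. emeasure lborel K + d)"
    using ne by (rule ennreal_SUP_add_left[symmetric])
  also have "\<dots> \<le> e" using le by (auto intro!: SUP_least)
  finally show ?thesis .
qed

lemma difference_emeasure:
  fixes A B :: "real set"
  assumes A: "A \<in> sets borel" "A \<noteq> {}" and B: "B \<in> sets borel" "B \<noteq> {}"
    and H: "H \<in> sets borel" and sub: "\<And>a b. a \<in> A \<Longrightarrow> b \<in> B \<Longrightarrow> a - b \<in> H"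
  shows "emeasure lborel A + emeasure lborel B \<le> emeasure lborel H"
proof (rule emeasure_add_le_of_compact[OF A])
  fix K assume K: "compact K" "K \<noteq> {}" "K \<subseteq> A"
  have "emeasure lborel B + emeasure lborel K \<le> emeasure lborel H"
  proof (rule emeasure_add_le_of_compact[OF B])
    fix L assume "compact L" "L \<noteq> {}" "L \<subseteq> B"
    then show "emeasure lborel L + emeasure lborel K \<le> emeasure lborel H"
      using compact_difference_emeasure[of K L H] K H sub by (auto simp: add.commute)
  qed
  then show "emeasure lborel K + emeasure lborel B \<le> emeasure lborel H" by (simp add: add.commute)
qed

lemma ennreal_amgm:
  fixes x y z :: ennreal
  assumes "x + y \<le> 2 * z"
  shows "x * y \<le> z\<^sup>2"
proof (cases z)
  case top
  then show ?thesis by (simp add: power2_eq_square)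
next
  case (real c)
  then have le: "x + y \<le> ennreal (2 * c)" using assms by (simp add: ennreal_mult')
  have "x \<le> x + y" "y \<le> x + y" by simp_all
  with le have "x \<noteq> top" "y \<noteq> top" by (metis ennreal_neq_top order_trans top_unique)+
  then obtain a b where ab: "x = ennreal a" "0 \<le> a" "y = ennreal b" "0 \<le> b"
    by (metis ennreal_cases)
  have "ennreal (a + b) \<le> ennreal (2 * c)" using le ab by simp
  then have "a + b \<le> 2 * c" using real(1) by (simp only: ennreal_le_iff mult_nonneg_nonneg zero_le_numeral)
  then have "(a + b)\<^sup>2 \<le> (2 * c)\<^sup>2" using ab by (intro power_mono) auto
  moreover have "4 * (a * b) \<le> (a + b)\<^sup>2"
    using zero_le_power2[of "a - b"] by (simp add: power2_eq_square algebra_simps)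
  ultimately have "a * b \<le> c\<^sup>2" by (simp add: power2_eq_square)
  then have "ennreal (a * b) \<le> ennreal (c\<^sup>2)" by (rule ennreal_leI)
  then show ?thesis using ab real by (simp add: ennreal_mult' ennreal_power)
qed

lemma ennreal_square_less_mono:
  fixes x y :: ennreal
  assumes "x\<^sup>2 < y\<^sup>2" shows "x < y"
proof (rule ccontr)
  assume "\<not> x < y"
  then have "y\<^sup>2 \<le> x\<^sup>2" by (intro power_mono) auto
  with assms show False by simp
qed

text \<open>
  A point of the level set \<open>{f > s}\<close> and one of \<open>{g > s}\<close> have half their difference in
  \<open>{h > s}\<close>, so Brunn--Minkowski on the line compares the measures of the level sets. Integration over
  the levels gives an additive inequality, which is stronger than the multiplicative one by the
  inequality between arithmetic and geometric means.
\<close>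
lemma prekopa_leindler_normalized:
  fixes f g h :: "real \<Rightarrow> ennreal"
  assumes [measurable]: "f \<in> borel_measurable borel" "g \<in> borel_measurable borel" "h \<in> borel_measurable borel"
    and f: "\<And>x. f x \<le> 1" "\<And>s. s < 1 \<Longrightarrow> \<exists>x. s < f x"
    and g: "\<And>x. g x \<le> 1" "\<And>s. s < 1 \<Longrightarrow> \<exists>x. s < g x"
    and fgh: "\<And>x y. f x * g y \<le> (h ((x - y) / 2))\<^sup>2"
  shows "(\<integral>\<^sup>+ x. f x \<partial>lborel) * (\<integral>\<^sup>+ x. g x \<partial>lborel) \<le> (\<integral>\<^sup>+ x. h x \<partial>lborel)\<^sup>2"
proof (rule ennreal_amgm)
  \<comment> \<open>Cutting \<open>h\<close> off at 1 brings it within reach of the layer cake formula and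
      leaves the level sets for levels below 1 unchanged.\<close>
  define k where "k x = min 1 (h (x / 2))" for x
  have [measurable]: "k \<in> borel_measurable borel" unfolding k_def by measurable
  have lev: "emeasure lborel {x. ennreal s < f x} + emeasure lborel {x. ennreal s < g x}
      \<le> emeasure lborel {x. ennreal s < k x}" if s: "0 < s" "s < 1" for s
  proof (rule difference_emeasure)
    fix x y assume "x \<in> {x. ennreal s < f x}" "y \<in> {x. ennreal s < g x}"
    moreover obtain u v where "f x = ennreal u" "0 \<le> u" "g y = ennreal v" "0 \<le> v"
      using f(1)[of x] g(1)[of y] by (cases "f x"; cases "g y") (auto simp: top_unique)
    ultimately have "ennreal s * ennreal s < f x * g y"
      using s by (simp add: ennreal_less_iff ennreal_mult'[symmetric] mult_strict_mono)
    also have "\<dots> \<le> (h ((x - y) / 2))\<^sup>2" by (rule fgh)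
    finally have "(ennreal s)\<^sup>2 < (h ((x - y) / 2))\<^sup>2" by (simp add: power2_eq_square)
    then have "ennreal s < h ((x - y) / 2)" by (rule ennreal_square_less_mono)
    moreover have "ennreal s < 1" using s by simp
    ultimately show "x - y \<in> {x. ennreal s < k x}" by (simp add: k_def)
  next
    show "{x. ennreal s < f x} \<noteq> {}" "{x. ennreal s < g x} \<noteq> {}"
      using f(2)[of "ennreal s"] g(2)[of "ennreal s"] s by auto
  qed measurable
  have "(\<integral>\<^sup>+ x. f x \<partial>lborel) + (\<integral>\<^sup>+ x. g x \<partial>lborel)
     = (\<integral>\<^sup>+ s\<in>{0<..<1}. (emeasure lborel {x. ennreal s < f x} + emeasure lborel {x. ennreal s < g x}) \<partial>lborel)"
    unfolding nn_integral_layer_cake[OF assms(1) f(1)] nn_integral_layer_cake[OF assms(2) g(1)]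
    by (subst nn_integral_add[symmetric]) (auto simp: distrib_right)
  also have "\<dots> \<le> (\<integral>\<^sup>+ s\<in>{0<..<1}. emeasure lborel {x. ennreal s < k x} \<partial>lborel)"
    using lev by (intro nn_integral_mono) (auto simp: indicator_def)
  also have "\<dots> = (\<integral>\<^sup>+ x. k x \<partial>lborel)"
    by (rule nn_integral_layer_cake[symmetric]) (auto simp: k_def)
  also have "\<dots> \<le> (\<integral>\<^sup>+ x. h (0 + (1/2) * x) \<partial>lborel)"
    by (intro nn_integral_mono) (auto simp: k_def)
  also have "\<dots> = 2 * (\<integral>\<^sup>+ x. h x \<partial>lborel)"
  proof -
    have "2 * (\<integral>\<^sup>+ x. h x \<partial>lborel) = (ennreal 2 * ennreal (1 / 2)) * (\<integral>\<^sup>+ x. h (0 + (1/2) * x) \<partial>lborel)"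
      using nn_integral_real_affine[of h "1/2" 0] by (simp add: mult.assoc)
    also have "ennreal 2 * ennreal (1 / 2) = 1" by (subst ennreal_mult'[symmetric]) simp_all
    finally show ?thesis by simp
  qed
  finally show "(\<integral>\<^sup>+ x. f x \<partial>lborel) + (\<integral>\<^sup>+ x. g x \<partial>lborel) \<le> 2 * (\<integral>\<^sup>+ x. h x \<partial>lborel)" .
qed

text \<open>
  Both sides of the hypothesis scale by the same factor when \<open>f\<close> and \<open>g\<close> are divided by their
  suprema \<open>a\<close>, \<open>b\<close> and \<open>h\<close> by the geometric mean of \<open>a\<close> and \<open>b\<close>.
\<close>
lemma prekopa_leindler_bounded:
  fixes f g h :: "real \<Rightarrow> ennreal"
  assumes [measurable]: "f \<in> borel_measurable borel" "g \<in> borel_measurable borel" "h \<in> borel_measurable borel"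
    and bd: "(SUP x. f x) < top" "(SUP x. g x) < top"
    and fgh: "\<And>x y. f x * g y \<le> (h ((x - y) / 2))\<^sup>2"
  shows "(\<integral>\<^sup>+ x. f x \<partial>lborel) * (\<integral>\<^sup>+ x. g x \<partial>lborel) \<le> (\<integral>\<^sup>+ x. h x \<partial>lborel)\<^sup>2"
proof (cases "(SUP x. f x) = 0 \<or> (SUP x. g x) = 0")
  case True
  moreover have "u x = 0" if "(SUP x. u x) = 0" for u :: "real \<Rightarrow> ennreal" and x
    using SUP_upper[of x UNIV u] that by simp
  ultimately have "(\<forall>x. f x = 0) \<or> (\<forall>x. g x = 0)" by blast
  then show ?thesis by auto
next
  case False
  have pos: "\<exists>r>0. S = ennreal r" if "S < top" "S \<noteq> 0" for S
  proof (cases S rule: ennreal_cases)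
    case (real r)
    then have "r \<noteq> 0" using that(2) by auto
    with real show ?thesis by (intro exI[of _ r]) auto
  qed (use that in simp)
  obtain a where a: "(SUP x. f x) = ennreal a" "0 < a"
    using pos[OF bd(1)] False by blast
  obtain b where b: "(SUP x. g x) = ennreal b" "0 < b"
    using pos[OF bd(2)] False by blast
  define c where "c = sqrt (a * b)"
  have c: "0 < c" "c * c = a * b" using a b by (auto simp: c_def)
  let ?f = "\<lambda>x. ennreal (1 / a) * f x" and ?g = "\<lambda>x. ennreal (1 / b) * g x"
    and ?h = "\<lambda>x. ennreal (1 / c) * h x"
  let ?F = "\<integral>\<^sup>+ x. f x \<partial>lborel" and ?G = "\<integral>\<^sup>+ x. g x \<partial>lborel" and ?H = "\<integral>\<^sup>+ x. h x \<partial>lborel"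
  have scale: "(\<forall>x. ennreal (1 / r) * u x \<le> 1) \<and> (\<forall>s<1. \<exists>x. s < ennreal (1 / r) * u x)"
    if r: "(SUP x. u x) = ennreal r" "0 < r" for u :: "real \<Rightarrow> ennreal" and r
  proof -
    have "(SUP x. ennreal (1 / r) * u x) = ennreal (1 / r) * (SUP x. u x)"
      by (rule SUP_mult_left_ennreal[symmetric])
    also have "\<dots> = 1" using r by (simp add: ennreal_mult'[symmetric])
    finally have S: "(SUP x. ennreal (1 / r) * u x) = 1" .
    show ?thesis
    proof (intro conjI allI impI)
      fix x show "ennreal (1 / r) * u x \<le> 1"
        using SUP_upper[of x UNIV "\<lambda>x. ennreal (1 / r) * u x"] S by simp
    next
      fix s :: ennreal assume "s < 1"
      then show "\<exists>x. s < ennreal (1 / r) * u x"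
        using S less_SUP_iff[of s "\<lambda>x. ennreal (1 / r) * u x" UNIV] by auto
    qed
  qed
  have "(\<integral>\<^sup>+ x. ?f x \<partial>lborel) * (\<integral>\<^sup>+ x. ?g x \<partial>lborel) \<le> (\<integral>\<^sup>+ x. ?h x \<partial>lborel)\<^sup>2"
  proof (rule prekopa_leindler_normalized)
    fix x y
    have "?f x * ?g y = ennreal (1 / (a * b)) * (f x * g y)"
      using a b by (simp add: divide_inverse ennreal_mult' mult_ac)
    also have "\<dots> \<le> ennreal (1 / (a * b)) * (h ((x - y) / 2))\<^sup>2"
      by (intro mult_left_mono fgh) auto
    also have "ennreal (1 / (a * b)) = (ennreal (1 / c))\<^sup>2"
      using c by (simp add: power2_eq_square divide_inverse ennreal_mult'[symmetric] flip: inverse_mult_distrib)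
    finally show "?f x * ?g y \<le> (?h ((x - y) / 2))\<^sup>2" by (simp add: power_mult_distrib)
  qed (use scale[OF a] scale[OF b] in auto)
  then have le: "(ennreal (1 / a) * ?F) * (ennreal (1 / b) * ?G) \<le> (ennreal (1 / c) * ?H)\<^sup>2"
    by (simp add: nn_integral_cmult)
  have ab: "ennreal (a * b) * (ennreal (1 / a) * ennreal (1 / b)) = 1"
    using a b by (simp add: ennreal_mult'[symmetric])
  have cc: "ennreal (a * b) * (ennreal (1 / c))\<^sup>2 = 1"
    using c(1) unfolding c(2)[symmetric] by (simp add: power2_eq_square ennreal_mult'[symmetric])
  have "?F * ?G = (ennreal (a * b) * (ennreal (1 / a) * ennreal (1 / b))) * (?F * ?G)"
    by (simp only: ab mult_1)
  also have "\<dots> = ennreal (a * b) * ((ennreal (1 / a) * ?F) * (ennreal (1 / b) * ?G))"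
    by (simp only: mult_ac)
  also have "\<dots> \<le> ennreal (a * b) * (ennreal (1 / c) * ?H)\<^sup>2"
    by (intro mult_left_mono le) simp
  also have "\<dots> = (ennreal (a * b) * (ennreal (1 / c))\<^sup>2) * ?H\<^sup>2"
    by (simp only: power_mult_distrib mult.assoc)
  also have "\<dots> = ?H\<^sup>2" by (simp only: cc mult_1)
  finally show ?thesis .
qed

lemma prekopa_leindler_real:
  fixes f g h :: "real \<Rightarrow> ennreal"
  assumes [measurable]: "f \<in> borel_measurable borel" "g \<in> borel_measurable borel" "h \<in> borel_measurable borel"
    and fgh: "\<And>x y. f x * g y \<le> (h ((x - y) / 2))\<^sup>2"
  shows "(\<integral>\<^sup>+ x. f x \<partial>lborel) * (\<integral>\<^sup>+ x. g x \<partial>lborel) \<le> (\<integral>\<^sup>+ x. h x \<partial>lborel)\<^sup>2"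
proof -
  have trunc: "(\<integral>\<^sup>+ x. u x \<partial>lborel) = (SUP n. \<integral>\<^sup>+ x. min (u x) (of_nat n) \<partial>lborel)"
    if [measurable]: "u \<in> borel_measurable borel" for u :: "real \<Rightarrow> ennreal"
  proof -
    have "u x = (SUP n. min (u x) (of_nat n))" for x
    proof -
      have "(SUP n. min (u x) (of_nat n)) = min (u x) (SUP n. of_nat n)"
        unfolding inf_min[symmetric] by (rule inf_SUP[symmetric])
      then show ?thesis by (simp add: ennreal_SUP_of_nat_eq_top)
    qed
    then have "(\<integral>\<^sup>+ x. u x \<partial>lborel) = (\<integral>\<^sup>+ x. (SUP n. min (u x) (of_nat n)) \<partial>lborel)"
      by (intro nn_integral_cong)
    also have "\<dots> = (SUP n. \<integral>\<^sup>+ x. min (u x) (of_nat n) \<partial>lborel)"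
    proof (rule nn_integral_monotone_convergence_SUP)
      show "incseq (\<lambda>n x. min (u x) (of_nat n))"
        unfolding incseq_def le_fun_def by (intro allI impI min.mono order_refl of_nat_mono)
    qed measurable
    finally show ?thesis .
  qed
  have "(\<integral>\<^sup>+ x. min (f x) (of_nat n) \<partial>lborel) * (\<integral>\<^sup>+ x. min (g x) (of_nat m) \<partial>lborel)
      \<le> (\<integral>\<^sup>+ x. h x \<partial>lborel)\<^sup>2" for n m
  proof (rule prekopa_leindler_bounded)
    have "(SUP x. min (u x) (of_nat n)) < top" for u :: "real \<Rightarrow> ennreal" and n
    proof -
      have "(SUP x. min (u x) (of_nat n)) \<le> of_nat n" by (intro SUP_least) simp
      also have "\<dots> < top" by (rule of_nat_less_top)
      finally show ?thesis .
    qed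
    then show "(SUP x. min (f x) (of_nat n)) < top" "(SUP x. min (g x) (of_nat m)) < top" by this+
    show "min (f x) (of_nat n) * min (g y) (of_nat m) \<le> (h ((x - y) / 2))\<^sup>2" for x y
      by (rule order_trans[OF mult_mono fgh]) auto
  qed measurable
  then have "(SUP m. (SUP n. (\<integral>\<^sup>+ x. min (f x) (of_nat n) \<partial>lborel) * (\<integral>\<^sup>+ x. min (g x) (of_nat m) \<partial>lborel)))
      \<le> (\<integral>\<^sup>+ x. h x \<partial>lborel)\<^sup>2"
    by (intro SUP_least)
  then show ?thesis
    unfolding trunc[OF assms(1)] trunc[OF assms(2)]
    by (simp only: SUP_mult_left_ennreal SUP_mult_right_ennreal)
qed

text \<open>
  The Prekopa--Leindler inequality in arbitrary dimension, stated with a difference instead of a sum so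
  that it can be applied directly to a set and its reflection. It tensorizes: integrating out one
  coordinate turns the hypothesis in dimension \<open>n + 1\<close> into the hypothesis in dimension \<open>n\<close>.
\<close>
lemma prekopa_leindler_PiM:
  fixes f g h :: "('i \<Rightarrow> real) \<Rightarrow> ennreal"
  assumes "finite I"
    and "f \<in> borel_measurable (Pi\<^sub>M I (\<lambda>_. lborel))" "g \<in> borel_measurable (Pi\<^sub>M I (\<lambda>_. lborel))"
      "h \<in> borel_measurable (Pi\<^sub>M I (\<lambda>_. lborel))"
    and "\<And>x y. x \<in> extensional I \<Longrightarrow> y \<in> extensional I \<Longrightarrow> f x * g y \<le> (h (\<lambda>i\<in>I. (x i - y i) / 2))\<^sup>2"
  shows "(\<integral>\<^sup>+ x. f x \<partial>Pi\<^sub>M I (\<lambda>_. lborel)) * (\<integral>\<^sup>+ x. g x \<partial>Pi\<^sub>M I (\<lambda>_. lborel))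
      \<le> (\<integral>\<^sup>+ x. h x \<partial>Pi\<^sub>M I (\<lambda>_. lborel))\<^sup>2"
  using assms
proof (induction I arbitrary: f g h rule: finite_induct)
  case empty
  interpret product_sigma_finite "\<lambda>_::'i. lborel :: real measure" by standard
  show ?case
    using empty(4)[of "\<lambda>_. undefined" "\<lambda>_. undefined"] by (simp add: nn_integral_empty restrict_def)
next
  case (insert j I)
  interpret product_sigma_finite "\<lambda>_::'i. lborel :: real measure" by standard
  note [measurable] = insert.prems(1-3)
  note split = product_nn_integral_insert[OF insert(1,2)]
  have upd: "x(j := t) \<in> extensional (insert j I)" if "x \<in> extensional I" for x :: "'i \<Rightarrow> real" and t
    using that by (auto simp: extensional_def)
  have meas: "(\<lambda>t. u (x(j := t))) \<in> borel_measurable borel"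
    if x: "x \<in> extensional I" and [measurable]: "u \<in> borel_measurable (Pi\<^sub>M (insert j I) (\<lambda>_. lborel))"
    for x :: "'i \<Rightarrow> real" and u :: "_ \<Rightarrow> ennreal"
  proof -
    have "x \<in> space (Pi\<^sub>M I (\<lambda>_. lborel))" using x by (simp add: space_PiM PiE_def)
    then have "(\<lambda>t. x(j := t)) \<in> measurable lborel (Pi\<^sub>M (insert j I) (\<lambda>_. lborel))"
      using insert(2) by (rule measurable_component_update)
    from measurable_compose[OF this that(2)] show ?thesis by simp
  qed
  show ?case
    unfolding split[OF insert.prems(1)] split[OF insert.prems(2)] split[OF insert.prems(3)]
  proof (rule insert.IH)
    fix x y :: "'i \<Rightarrow> real" assume x: "x \<in> extensional I" and y: "y \<in> extensional I"
    let ?z = "\<lambda>i\<in>I. (x i - y i) / 2"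
    show "(\<integral>\<^sup>+ t. f (x(j := t)) \<partial>lborel) * (\<integral>\<^sup>+ t. g (y(j := t)) \<partial>lborel)
        \<le> (\<integral>\<^sup>+ t. h (?z(j := t)) \<partial>lborel)\<^sup>2"
    proof (rule prekopa_leindler_real)
      fix s t
      have "(\<lambda>i\<in>insert j I. ((x(j := s)) i - (y(j := t)) i) / 2) = ?z(j := (s - t) / 2)"
        using insert(2) by (auto simp: fun_eq_iff)
      then show "f (x(j := s)) * g (y(j := t)) \<le> (h (?z(j := (s - t) / 2)))\<^sup>2"
        using insert.prems(4)[OF upd[OF x, of s] upd[OF y, of t]] by (simp only:)
    qed (auto intro!: meas x y insert.prems)
  qed measurable
qed


section \<open>Steiner symmetrization and polar sets\<close>

definition polar_set :: "'a::euclidean_space set \<Rightarrow> 'a set" where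
  "polar_set A = {y. \<forall>x\<in>A. x \<bullet> y \<le> 1}"

lemma closed_polar_set: "closed (polar_set A)"
proof -
  have "polar_set A = (\<Inter>x\<in>A. {y. x \<bullet> y \<le> 1})" by (auto simp: polar_set_def)
  then show ?thesis by (auto intro!: closed_halfspace_le)
qed

lemma borel_polar_set [measurable]: "polar_set A \<in> sets borel"
  by (intro borel_closed closed_polar_set)

lemma polar_set_antimono: "A \<subseteq> B \<Longrightarrow> polar_set B \<subseteq> polar_set A"
  by (auto simp: polar_set_def)

definition chord :: "'a::euclidean_space \<Rightarrow> 'a set \<Rightarrow> 'a \<Rightarrow> ennreal" where
  "chord e A z = emeasure lborel {t. z + t *\<^sub>R e \<in> A}"

text \<open>
  Chord length is constant along lines in direction \<open>e\<close>, so on each such line the condition below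
  describes an open interval centred at the hyperplane orthogonal to \<open>e\<close>.
\<close>
definition steiner :: "'a::euclidean_space \<Rightarrow> 'a set \<Rightarrow> 'a set" where
  "steiner e A = {z. ennreal (2 * \<bar>z \<bullet> e\<bar>) < chord e A z}"

lemma chord_measurable [measurable]:
  assumes [measurable]: "A \<in> sets borel"
  shows "chord e A \<in> borel_measurable borel"
proof -
  have "{p \<in> space (borel \<Otimes>\<^sub>M lborel). fst p + snd p *\<^sub>R e \<in> A} \<in> sets (borel \<Otimes>\<^sub>M lborel)"
    by measurable
  from lborel.measurable_emeasure_Pair[OF this]
  show ?thesis by (simp add: chord_def[abs_def] space_pair_measure vimage_def)
qed

lemma steiner_borel [measurable]:
  assumes [measurable]: "A \<in> sets borel"
  shows "steiner e A \<in> sets borel"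
  unfolding steiner_def by measurable

lemma chord_shift:
  assumes [measurable]: "A \<in> sets borel"
  shows "chord e A (z + s *\<^sub>R e) = chord e A z"
proof -
  have m: "{t. z + t *\<^sub>R e \<in> A} \<in> sets borel" by measurable
  have "chord e A z = emeasure (distr lborel borel ((+) s)) {t. z + t *\<^sub>R e \<in> A}"
    by (simp add: chord_def lborel_distr_plus)
  also have "\<dots> = emeasure lborel {t. z + (s + t) *\<^sub>R e \<in> A}"
    using m by (subst emeasure_distr) (auto simp: vimage_def)
  also have "\<dots> = chord e A (z + s *\<^sub>R e)" by (simp add: chord_def scaleR_add_left add.assoc)
  finally show ?thesis ..
qed

lemma chord_uminus:
  assumes [measurable]: "A \<in> sets borel" and sym: "\<And>x. - x \<in> A \<longleftrightarrow> x \<in> A"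
  shows "chord e A (- z) = chord e A z"
proof -
  have m: "{t. z + t *\<^sub>R e \<in> A} \<in> sets borel" by measurable
  have "chord e A z = emeasure (distr lborel borel uminus) {t. z + t *\<^sub>R e \<in> A}"
    by (simp add: chord_def lborel_distr_uminus)
  also have "\<dots> = emeasure lborel {t. z + (- t) *\<^sub>R e \<in> A}"
    using m by (subst emeasure_distr) (auto simp: vimage_def)
  also have "\<dots> = chord e A (- z)"
  proof -
    have "z + (- t) *\<^sub>R e \<in> A \<longleftrightarrow> - z + t *\<^sub>R e \<in> A" for t
      using sym[of "z + (- t) *\<^sub>R e"] by simp
    then show ?thesis unfolding chord_def by presburger
  qed
  finally show ?thesis ..
qed

lemma steiner_uminus:
  assumes "A \<in> sets borel" "\<And>x. - x \<in> A \<longleftrightarrow> x \<in> A"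
  shows "- z \<in> steiner e A \<longleftrightarrow> z \<in> steiner e A"
  using chord_uminus[OF assms] by (simp add: steiner_def)

text \<open>
  A Steiner symmetral meets each line in direction \<open>e\<close> in a set of this form, the centred open
  interval whose length is the chord length; \<open>c\<close> may be infinite.
\<close>
lemma emeasure_centred_interval: "emeasure lborel {t::real. ennreal (2 * \<bar>t\<bar>) < c} = c"
proof (cases c rule: ennreal_cases)
  case (real r)
  then have "{t::real. ennreal (2 * \<bar>t\<bar>) < c} = {- (r / 2)<..<r / 2}"
    by (auto simp: ennreal_less_iff abs_less_iff)
  then show ?thesis using real by simp
qed simp

lemma chord_steiner:
  assumes A: "A \<in> sets borel" and w: "w \<bullet> e = 0" and e: "norm e = 1"
  shows "{t. w + t *\<^sub>R e \<in> steiner e A} = {t. ennreal (2 * \<bar>t\<bar>) < chord e A w}"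
proof -
  have "(w + t *\<^sub>R e) \<bullet> e = t" for t
    using w e by (simp add: inner_add_left dot_square_norm)
  then show ?thesis by (simp add: steiner_def chord_shift[OF A])
qed

text \<open>
  Coordinates on the hyperplane orthogonal to the basis vector \<open>e\<close>, in the form in which the
  product measure over the remaining basis vectors sees them.
\<close>
definition emb :: "'a::euclidean_space \<Rightarrow> ('a \<Rightarrow> real) \<Rightarrow> 'a" where
  "emb e x = (\<Sum>b\<in>Basis - {e}. x b *\<^sub>R b)"

lemma emb_inner: "e \<in> Basis \<Longrightarrow> emb e x \<bullet> e = 0"
  unfolding emb_def by (subst inner_sum_left) (auto simp: inner_Basis intro!: sum.neutral)

lemma emb_measurable [measurable]:
  "emb (e::'a::euclidean_space) \<in> Pi\<^sub>M (Basis - {e}) (\<lambda>_. lborel) \<rightarrow>\<^sub>M borel"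
  unfolding emb_def by measurable

lemma
  fixes f :: "'a::euclidean_space \<Rightarrow> ennreal"
  assumes e: "e \<in> Basis" and [measurable]: "f \<in> borel_measurable borel"
  shows nn_integral_lines: "(\<integral>\<^sup>+ z. f z \<partial>lborel)
      = (\<integral>\<^sup>+ x. \<integral>\<^sup>+ t. f (emb e x + t *\<^sub>R e) \<partial>lborel \<partial>Pi\<^sub>M (Basis - {e}) (\<lambda>_. lborel))"
    and nn_integral_hyperplanes: "(\<integral>\<^sup>+ z. f z \<partial>lborel)
      = (\<integral>\<^sup>+ t. \<integral>\<^sup>+ x. f (emb e x + t *\<^sub>R e) \<partial>Pi\<^sub>M (Basis - {e}) (\<lambda>_. lborel) \<partial>lborel)"
proof -
  interpret product_sigma_finite "\<lambda>_::'a. lborel :: real measure" by standard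
  define I where "I = Basis - {e}"
  have I: "finite I" "e \<notin> I" and B: "(Basis :: 'a set) = insert e I" using e by (auto simp: I_def)
  let ?g = "\<lambda>x. f (\<Sum>b\<in>insert e I. x b *\<^sub>R b)"
  have [measurable]: "?g \<in> borel_measurable (Pi\<^sub>M (insert e I) (\<lambda>_. lborel))" by measurable
  have pt: "(\<Sum>b\<in>insert e I. (x(e := t)) b *\<^sub>R b) = emb e x + t *\<^sub>R e" for x t
  proof -
    have "(\<Sum>b\<in>I. (x(e := t)) b *\<^sub>R b) = (\<Sum>b\<in>I. x b *\<^sub>R b)"
      using I by (intro sum.cong) auto
    then show ?thesis using I by (simp add: emb_def I_def[symmetric] add.commute)
  qed
  have "(\<integral>\<^sup>+ z. f z \<partial>lborel) = (\<integral>\<^sup>+ x. ?g x \<partial>Pi\<^sub>M (insert e I) (\<lambda>_. lborel))"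
    by (subst lborel_eq, subst nn_integral_distr) (simp_all add: B)
  then show "(\<integral>\<^sup>+ z. f z \<partial>lborel) = (\<integral>\<^sup>+ x. \<integral>\<^sup>+ t. f (emb e x + t *\<^sub>R e) \<partial>lborel \<partial>Pi\<^sub>M (Basis - {e}) (\<lambda>_. lborel))"
    and "(\<integral>\<^sup>+ z. f z \<partial>lborel) = (\<integral>\<^sup>+ t. \<integral>\<^sup>+ x. f (emb e x + t *\<^sub>R e) \<partial>Pi\<^sub>M (Basis - {e}) (\<lambda>_. lborel) \<partial>lborel)"
    using product_nn_integral_insert[OF I, of ?g] product_nn_integral_insert_rev[OF I, of ?g]
    by (simp_all only: pt I_def[symmetric]) simp_all
qed

lemma emeasure_lines:
  fixes A :: "'a::euclidean_space set"
  assumes e: "e \<in> Basis" and [measurable]: "A \<in> sets borel"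
  shows "emeasure lborel A = (\<integral>\<^sup>+ x. chord e A (emb e x) \<partial>Pi\<^sub>M (Basis - {e}) (\<lambda>_. lborel))"
proof -
  have "emeasure lborel A = (\<integral>\<^sup>+ z. indicator A z \<partial>lborel)" by simp
  also have "\<dots> = (\<integral>\<^sup>+ x. \<integral>\<^sup>+ t. indicator A (emb e x + t *\<^sub>R e) \<partial>lborel \<partial>Pi\<^sub>M (Basis - {e}) (\<lambda>_. lborel))"
    using e by (rule nn_integral_lines) measurable
  also have "(\<lambda>x. \<integral>\<^sup>+ t. indicator A (emb e x + t *\<^sub>R e) \<partial>lborel) = (\<lambda>x. chord e A (emb e x))"
  proof
    fix x
    have "(\<integral>\<^sup>+ t. indicator A (emb e x + t *\<^sub>R e) \<partial>lborel) = (\<integral>\<^sup>+ t. indicator {t. emb e x + t *\<^sub>R e \<in> A} t \<partial>lborel)"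
      by (intro nn_integral_cong) (auto simp: indicator_def)
    also have "\<dots> = chord e A (emb e x)" unfolding chord_def by (rule nn_integral_indicator) measurable
    finally show "(\<integral>\<^sup>+ t. indicator A (emb e x + t *\<^sub>R e) \<partial>lborel) = chord e A (emb e x)" .
  qed
  finally show ?thesis .
qed

lemma emeasure_steiner:
  fixes A :: "'a::euclidean_space set"
  assumes e: "e \<in> Basis" and A [measurable]: "A \<in> sets borel"
  shows "emeasure lborel (steiner e A) = emeasure lborel A"
proof -
  have "chord e (steiner e A) (emb e x) = chord e A (emb e x)" for x
    unfolding chord_def[of e "steiner e A"] chord_steiner[OF A emb_inner[OF e] norm_Basis[OF e]]
    by (rule emeasure_centred_interval)
  then show ?thesis by (simp add: emeasure_lines[OF e])
qed

text \<open>
  Symmetrization cannot decrease the overlap of two sets, and it gains at least the amount of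
  \<open>A - B\<close> that a translation along \<open>e\<close> moves into \<open>B - A\<close>. Indeed, on each line the two
  symmetrals are nested intervals, so they overlap in the shorter of the two lengths, while \<open>A\<close> and
  \<open>B\<close> each exceed their overlap by at least the length that is moved.
\<close>
lemma emeasure_steiner_Int:
  fixes A B :: "'a::euclidean_space set"
  assumes e: "e \<in> Basis" and A [measurable]: "A \<in> sets borel" and B [measurable]: "B \<in> sets borel"
  shows "emeasure lborel (A \<inter> B) + emeasure lborel {x. x \<in> A - B \<and> x + c *\<^sub>R e \<in> B - A}
      \<le> emeasure lborel (steiner e A \<inter> steiner e B)"
proof -
  let ?M = "{x. x \<in> A - B \<and> x + c *\<^sub>R e \<in> B - A}"
  have M [measurable]: "?M \<in> sets borel" by measurable
  have le: "chord e (A \<inter> B) w + chord e ?M w \<le> chord e (steiner e A \<inter> steiner e B) w" if w: "w \<bullet> e = 0" for w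
  proof -
    have add: "chord e (X \<union> Y) z = chord e X z + chord e Y z"
      if [measurable]: "X \<in> sets borel" "Y \<in> sets borel" and "X \<inter> Y = {}" for X Y z
    proof -
      have "{t. z + t *\<^sub>R e \<in> X \<union> Y} = {t. z + t *\<^sub>R e \<in> X} \<union> {t. z + t *\<^sub>R e \<in> Y}" by auto
      moreover have "{t. z + t *\<^sub>R e \<in> X} \<inter> {t. z + t *\<^sub>R e \<in> Y} = {}" using that(3) by auto
      ultimately show ?thesis unfolding chord_def by (simp add: plus_emeasure)
    qed
    have mono: "chord e X z \<le> chord e Y z"
      if [measurable]: "Y \<in> sets borel" and "X \<subseteq> Y" for X Y z
      unfolding chord_def using that(2) by (intro emeasure_mono) auto
    have MA: "chord e ?M w \<le> chord e (A - B) w" by (rule mono) auto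
    have "{t. w + t *\<^sub>R e \<in> ?M} \<subseteq> {t. (w + c *\<^sub>R e) + t *\<^sub>R e \<in> B - A}" by (auto simp: add_ac)
    then have "chord e ?M w \<le> chord e (B - A) (w + c *\<^sub>R e)"
      unfolding chord_def by (intro emeasure_mono) auto
    then have MB: "chord e ?M w \<le> chord e (B - A) w" by (subst (asm) chord_shift) auto
    have "chord e A w = chord e (A \<inter> B) w + chord e (A - B) w"
      by (subst add[symmetric]) (auto simp: Int_Diff_Un)
    moreover have "chord e B w = chord e (A \<inter> B) w + chord e (B - A) w"
      by (subst add[symmetric]) (auto simp: Int_Diff_Un Int_commute[of A])
    ultimately have "chord e (A \<inter> B) w + chord e ?M w \<le> min (chord e A w) (chord e B w)"
      using MA MB by (simp add: add_left_mono)
    also have "\<dots> = emeasure lborel {t. ennreal (2 * \<bar>t\<bar>) < min (chord e A w) (chord e B w)}"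
      by (rule emeasure_centred_interval[symmetric])
    also have "{t. ennreal (2 * \<bar>t\<bar>) < min (chord e A w) (chord e B w)}
        = {t. w + t *\<^sub>R e \<in> steiner e A} \<inter> {t. w + t *\<^sub>R e \<in> steiner e B}"
      unfolding chord_steiner[OF A w norm_Basis[OF e]] chord_steiner[OF B w norm_Basis[OF e]] by auto
    also have "emeasure lborel \<dots> = chord e (steiner e A \<inter> steiner e B) w"
      unfolding chord_def by (rule arg_cong[where f = "emeasure lborel"]) auto
    finally show ?thesis .
  qed
  have "emeasure lborel (A \<inter> B) + emeasure lborel ?M
      = (\<integral>\<^sup>+ x. chord e (A \<inter> B) (emb e x) + chord e ?M (emb e x) \<partial>Pi\<^sub>M (Basis - {e}) (\<lambda>_. lborel))"
    by (subst (1 2) emeasure_lines[OF e]) (auto intro!: nn_integral_add[symmetric])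
  also have "\<dots> \<le> (\<integral>\<^sup>+ x. chord e (steiner e A \<inter> steiner e B) (emb e x) \<partial>Pi\<^sub>M (Basis - {e}) (\<lambda>_. lborel))"
    using le emb_inner[OF e] by (intro nn_integral_mono) auto
  also have "\<dots> = emeasure lborel (steiner e A \<inter> steiner e B)"
    by (rule emeasure_lines[symmetric, OF e]) measurable
  finally show ?thesis .
qed

text \<open>
  A set of reals all of whose differences are below \<open>d\<close> lies in an interval of length \<open>d\<close>. So a
  chord that is long in measure contains two points that are far apart.
\<close>
lemma steiner_witness:
  assumes "z \<in> steiner e A"
  obtains s t where "z + s *\<^sub>R e \<in> A" "z + t *\<^sub>R e \<in> A" "2 * \<bar>z \<bullet> e\<bar> \<le> s - t"
proof (rule ccontr)
  assume "\<not> thesis"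
  with that have *: "s - t < 2 * \<bar>z \<bullet> e\<bar>" if "z + s *\<^sub>R e \<in> A" "z + t *\<^sub>R e \<in> A" for s t
    using that by (meson not_le)
  let ?X = "{t. z + t *\<^sub>R e \<in> A}"
  have lt: "ennreal (2 * \<bar>z \<bullet> e\<bar>) < emeasure lborel ?X"
    using assms by (simp add: steiner_def chord_def)
  then have "?X \<noteq> {}" by (metis emeasure_empty not_less_zero)
  then obtain t0 where t0: "t0 \<in> ?X" by blast
  have bdd: "bdd_below ?X"
    by (rule bdd_belowI[of _ "t0 - 2 * \<bar>z \<bullet> e\<bar>"]) (use * t0 in force)
  have "?X \<subseteq> {Inf ?X..Inf ?X + 2 * \<bar>z \<bullet> e\<bar>}"
  proof
    fix s assume s: "s \<in> ?X"
    have "s - 2 * \<bar>z \<bullet> e\<bar> \<le> Inf ?X"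
      using \<open>?X \<noteq> {}\<close> by (rule cInf_greatest) (use * s in force)
    then show "s \<in> {Inf ?X..Inf ?X + 2 * \<bar>z \<bullet> e\<bar>}"
      using cInf_lower[OF s bdd] by simp
  qed
  then have "emeasure lborel ?X \<le> emeasure lborel {Inf ?X..Inf ?X + 2 * \<bar>z \<bullet> e\<bar>}"
    by (intro emeasure_mono) auto
  also have "\<dots> = ennreal (2 * \<bar>z \<bullet> e\<bar>)" by simp
  finally show False using lt by simp
qed

lemma norm_line_square:
  fixes z e :: "'a::real_inner"
  assumes "norm e = 1"
  shows "(norm (z + t *\<^sub>R e))\<^sup>2 = (norm z)\<^sup>2 - (z \<bullet> e)\<^sup>2 + (z \<bullet> e + t)\<^sup>2"
proof -
  have "e \<bullet> e = 1" using assms by (simp add: dot_square_norm)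
  then show ?thesis
    unfolding power2_norm_eq_inner
    by (simp add: inner_add_left inner_add_right power2_eq_square inner_commute algebra_simps)
qed

lemma steiner_subset_ball:
  assumes e: "norm e = 1" and A: "A \<subseteq> ball 0 R"
  shows "steiner e A \<subseteq> ball 0 R"
proof
  fix z assume "z \<in> steiner e A"
  then obtain s t where st: "z + s *\<^sub>R e \<in> A" "z + t *\<^sub>R e \<in> A" "2 * \<bar>z \<bullet> e\<bar> \<le> s - t"
    by (rule steiner_witness)
  then have "\<bar>z \<bullet> e\<bar> \<le> \<bar>z \<bullet> e + s\<bar> \<or> \<bar>z \<bullet> e\<bar> \<le> \<bar>z \<bullet> e + t\<bar>" by linarith
  then obtain u where u: "z + u *\<^sub>R e \<in> A" "\<bar>z \<bullet> e\<bar> \<le> \<bar>z \<bullet> e + u\<bar>" using st by blast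
  then have "(norm z)\<^sup>2 \<le> (norm (z + u *\<^sub>R e))\<^sup>2"
    unfolding norm_line_square[OF e] by (simp add: abs_le_square_iff)
  then have "norm z \<le> norm (z + u *\<^sub>R e)" by (rule power2_le_imp_le) simp
  with u A show "z \<in> ball 0 R" by (auto simp: subset_iff)
qed

lemma steiner_ball:
  fixes e :: "'a::euclidean_space"
  assumes e: "norm e = 1" and R: "0 < R"
  shows "steiner e (ball 0 R) = ball 0 R"
proof -
  have sq: "(norm u)\<^sup>2 < R\<^sup>2 \<longleftrightarrow> u \<in> ball 0 R" for u :: 'a
    using R by (auto intro: power_strict_mono power_less_imp_less_base[of _ 2])
  have "z \<in> steiner e (ball 0 R) \<longleftrightarrow> z \<in> ball 0 R" for z
  proof -
    define s where "s = z \<bullet> e"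
    define d where "d = R\<^sup>2 - (norm z)\<^sup>2 + s\<^sup>2"
    have "z + t *\<^sub>R e \<in> ball 0 R \<longleftrightarrow> t \<in> {- sqrt d - s<..<sqrt d - s}" for t
    proof -
      have "z + t *\<^sub>R e \<in> ball 0 R \<longleftrightarrow> (norm (z + t *\<^sub>R e))\<^sup>2 < R\<^sup>2"
        by (rule sq[symmetric])
      also have "\<dots> \<longleftrightarrow> (s + t)\<^sup>2 < d"
        unfolding norm_line_square[OF e] s_def[symmetric] d_def by linarith
      also have "\<dots> \<longleftrightarrow> sqrt ((s + t)\<^sup>2) < sqrt d" by (rule real_sqrt_less_iff[symmetric])
      also have "\<dots> \<longleftrightarrow> t \<in> {- sqrt d - s<..<sqrt d - s}" by (auto simp: abs_less_iff)
      finally show ?thesis .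
    qed
    then have "{t. z + t *\<^sub>R e \<in> ball 0 R} = {- sqrt d - s<..<sqrt d - s}" by blast
    then have "chord e (ball 0 R) z = ennreal (2 * sqrt d)"
      by (cases "0 \<le> sqrt d") (auto simp: chord_def ennreal_neg not_le)
    then have "z \<in> steiner e (ball 0 R) \<longleftrightarrow> ennreal (2 * \<bar>s\<bar>) < ennreal (2 * sqrt d)"
      by (simp add: steiner_def s_def)
    also have "\<dots> \<longleftrightarrow> sqrt (s\<^sup>2) < sqrt d" by (simp add: ennreal_less_iff)
    also have "\<dots> \<longleftrightarrow> (norm z)\<^sup>2 < R\<^sup>2" unfolding real_sqrt_less_iff by (simp add: d_def)
    also have "\<dots> \<longleftrightarrow> z \<in> ball 0 R" by (rule sq)
    finally show ?thesis .
  qed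
  then show ?thesis by blast
qed

text \<open>
  Why symmetrization enlarges the polar. For \<open>z\<close> in the symmetral there are two points of \<open>A\<close>
  on the same line at distance at least twice the height of \<open>z\<close>. Averaging the polar inequality of
  \<open>x + t e\<close> at one of them with that of \<open>y + t e\<close> at the mirror image of the other gives the polar
  inequality for \<open>z\<close>.
\<close>
lemma polar_set_steiner_combine:
  fixes A :: "'a::euclidean_space set"
  assumes sym: "\<And>x. x \<in> A \<Longrightarrow> - x \<in> A" and e: "norm e = 1"
    and x: "x \<bullet> e = 0" and y: "y \<bullet> e = 0"
    and P: "x + t *\<^sub>R e \<in> polar_set A" "y + t *\<^sub>R e \<in> polar_set A"
  shows "(1 / 2) *\<^sub>R (x - y) + t *\<^sub>R e \<in> polar_set (steiner e A)"
  unfolding polar_set_def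
proof (intro CollectI ballI)
  fix z assume "z \<in> steiner e A"
  then obtain s u where su: "z + s *\<^sub>R e \<in> A" "z + u *\<^sub>R e \<in> A" "2 * \<bar>z \<bullet> e\<bar> \<le> s - u"
    by (rule steiner_witness)
  have ee: "e \<bullet> e = 1" using e by (simp add: dot_square_norm)
  have ip: "(z + r *\<^sub>R e) \<bullet> (v + t *\<^sub>R e) = z \<bullet> v + (z \<bullet> e + r) * t" if "v \<bullet> e = 0" for r v
  proof -
    have "e \<bullet> v = 0" using that by (simp add: inner_commute)
    with ee show ?thesis by (simp add: inner_add_left inner_add_right distrib_right mult.commute)
  qed
  have bound_x: "z \<bullet> x + (z \<bullet> e + r) * t \<le> 1" if "z + r *\<^sub>R e \<in> A" for r
    using P(1) that ip[OF x, of r] by (auto simp: polar_set_def)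
  have bound_y: "- (z \<bullet> y + (z \<bullet> e + r) * t) \<le> 1" if "z + r *\<^sub>R e \<in> A" for r
  proof -
    have "(- (z + r *\<^sub>R e)) \<bullet> (y + t *\<^sub>R e) \<le> 1"
      using P(2) sym[OF that] unfolding polar_set_def by blast
    then show ?thesis using ip[OF y, of r] by (simp only: inner_minus_left)
  qed
  have "z \<bullet> x - z \<bullet> y + 2 * (z \<bullet> e) * t \<le> 2"
  proof (cases "0 \<le> t")
    case True
    have "2 * (z \<bullet> e) * t \<le> (s - u) * t" using su(3) True by (intro mult_right_mono) auto
    then show ?thesis using bound_x[OF su(1)] bound_y[OF su(2)] by (simp add: algebra_simps)
  next
    case False
    have "2 * (z \<bullet> e) * t \<le> (u - s) * t" using su(3) False by (intro mult_right_mono_neg) auto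
    then show ?thesis using bound_x[OF su(2)] bound_y[OF su(1)] by (simp add: algebra_simps)
  qed
  then show "z \<bullet> ((1 / 2) *\<^sub>R (x - y) + t *\<^sub>R e) \<le> 1"
    by (simp add: inner_add_right inner_diff_right algebra_simps)
qed

lemma ennreal_mult_strict_mono_diag:
  fixes x y :: ennreal
  assumes "x < y" shows "x * x < y * y"
proof -
  obtain a where a: "x = ennreal a" "0 \<le> a" using assms by (cases x) auto
  show ?thesis
  proof (cases y rule: ennreal_cases)
    case (real b)
    then have "a < b" using assms a by (simp add: ennreal_less_iff)
    then have "a * a < b * b" using a by (intro mult_strict_mono) auto
    then show ?thesis using a real by (simp add: ennreal_less_iff ennreal_mult'[symmetric])
  next
    case top
    have "x * x < top" unfolding a(1) ennreal_mult'[OF a(2), symmetric] by simp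
    then show ?thesis using top by simp
  qed
qed

text \<open>
  At each height, the slice of the new polar contains half the difference set of the slice of the old
  one. By Prekopa--Leindler this difference set has at least the measure of the slice itself.
\<close>
lemma emeasure_polar_set_steiner:
  fixes A :: "'a::euclidean_space set"
  assumes e: "e \<in> Basis" and sym: "\<And>x. x \<in> A \<Longrightarrow> - x \<in> A"
  shows "emeasure lborel (polar_set A) \<le> emeasure lborel (polar_set (steiner e A))"
proof -
  let ?M = "Pi\<^sub>M (Basis - {e}) (\<lambda>_. lborel) :: ('a \<Rightarrow> real) measure"
  have slice: "(\<integral>\<^sup>+ x. indicator (polar_set A) (emb e x + t *\<^sub>R e) \<partial>?M)
      \<le> (\<integral>\<^sup>+ x. indicator (polar_set (steiner e A)) (emb e x + t *\<^sub>R e) \<partial>?M)" (is "?F \<le> ?H") for t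
  proof (rule ccontr)
    assume "\<not> ?thesis"
    then have "?H < ?F" by simp
    moreover have "?F * ?F \<le> ?H\<^sup>2"
    proof (rule prekopa_leindler_PiM)
      fix x y :: "'a \<Rightarrow> real"
      let ?z = "\<lambda>i\<in>Basis - {e}. (x i - y i) / 2"
      have "emb e ?z = (\<Sum>b\<in>Basis - {e}. ((x b - y b) / 2) *\<^sub>R b)"
        unfolding emb_def by (rule sum.cong) auto
      also have "\<dots> = (1 / 2) *\<^sub>R (emb e x - emb e y)"
        by (simp add: emb_def scaleR_sum_right sum_subtractf[symmetric] scaleR_diff_left[symmetric])
      finally have "emb e ?z = (1 / 2) *\<^sub>R (emb e x - emb e y)" .
      then show "indicator (polar_set A) (emb e x + t *\<^sub>R e) * indicator (polar_set A) (emb e y + t *\<^sub>R e)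
          \<le> (indicator (polar_set (steiner e A)) (emb e ?z + t *\<^sub>R e) :: ennreal)\<^sup>2"
        using polar_set_steiner_combine[OF sym norm_Basis[OF e] emb_inner[OF e, of x] emb_inner[OF e, of y], of t]
        by (auto simp: indicator_def)
    qed simp_all
    ultimately show False
      using ennreal_mult_strict_mono_diag[of ?H ?F] by (simp add: power2_eq_square leD)
  qed
  have "emeasure lborel (polar_set A) = (\<integral>\<^sup>+ z. indicator (polar_set A) z \<partial>lborel)" by simp
  also have "\<dots> = (\<integral>\<^sup>+ t. \<integral>\<^sup>+ x. indicator (polar_set A) (emb e x + t *\<^sub>R e) \<partial>?M \<partial>lborel)"
    using e by (rule nn_integral_hyperplanes) measurable
  also have "\<dots> \<le> (\<integral>\<^sup>+ t. \<integral>\<^sup>+ x. indicator (polar_set (steiner e A)) (emb e x + t *\<^sub>R e) \<partial>?M \<partial>lborel)"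
    by (intro nn_integral_mono slice)
  also have "\<dots> = (\<integral>\<^sup>+ z. indicator (polar_set (steiner e A)) z \<partial>lborel)"
    using e by (rule nn_integral_hyperplanes[symmetric]) measurable
  also have "\<dots> = emeasure lborel (polar_set (steiner e A))" by simp
  finally show ?thesis .
qed


section \<open>The Blaschke--Santalo inequality for symmetric Borel sets\<close>

text \<open>
  The reflection in the hyperplane orthogonal to \<open>a - b\<close>. If \<open>a = b\<close>, division by zero makes
  the formula the identity. Working with an involution avoids inverses.
\<close>
lemma reflection_exists:
  fixes a b :: "'a::real_inner"
  assumes "norm a = norm b"
  obtains T where "linear T" "\<And>x. T (T x) = x" "\<And>x y. T x \<bullet> T y = x \<bullet> y" "T a = b"
proof -
  define w where "w = a - b"
  define T where "T x = x - (2 * (x \<bullet> w) / (w \<bullet> w)) *\<^sub>R w" for x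
  have lin: "linear T"
    unfolding T_def by (rule linearI) (simp_all add: inner_add_left scaleR_diff_right add_divide_distrib distrib_left scaleR_add_left)
  have Tw: "T x \<bullet> w = - (x \<bullet> w)" for x
    by (cases "w = 0") (simp_all add: T_def inner_diff_left)
  show thesis
  proof
    show "linear T" by (rule lin)
    show "T (T x) = x" for x
    proof -
      have "T (T x) = T x - (2 * (T x \<bullet> w) / (w \<bullet> w)) *\<^sub>R w" by (simp add: T_def[of "T x"])
      then show ?thesis unfolding Tw by (simp add: T_def)
    qed
    show "T x \<bullet> T y = x \<bullet> y" for x y
    proof -
      have "T x \<bullet> T y = T x \<bullet> y - (2 * (y \<bullet> w) / (w \<bullet> w)) * (T x \<bullet> w)"
        by (simp add: T_def[of y] inner_diff_right)
      also have "\<dots> = x \<bullet> y"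
        unfolding Tw by (simp add: T_def inner_diff_left inner_commute[of w y])
      finally show ?thesis .
    qed
    have aa: "a \<bullet> a = b \<bullet> b" using assms by (simp add: norm_eq)
    have "w \<bullet> w = 2 * (a \<bullet> w)"
      using aa by (simp add: w_def inner_diff_left inner_diff_right inner_commute)
    then show "T a = b"
      by (cases "w = 0") (auto simp: T_def w_def)
  qed
qed

lemma emeasure_ball_pos:
  fixes c :: "'a::euclidean_space"
  shows "0 < r \<Longrightarrow> 0 < emeasure lborel (ball c r)"
  by (simp add: emeasure_ball)

text \<open>
  The uniqueness argument for translation-invariant measures: computing the double integral of
  \<open>1_U(y) 1_A(T x + y)\<close> in both orders gives \<open>|U| |T -` A|\<close> and \<open>|U| |A|\<close>, because \<open>T\<close>
  preserves the unit ball \<open>U\<close>.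
\<close>
lemma emeasure_isometry_vimage:
  fixes T :: "'a::euclidean_space \<Rightarrow> 'a"
  assumes lin: "linear T" and inv: "\<And>x. T (T x) = x" and ip: "\<And>x y. T x \<bullet> T y = x \<bullet> y"
    and A [measurable]: "A \<in> sets borel"
  shows "emeasure lborel (T -` A) = emeasure lborel A"
proof -
  have cont: "continuous_on UNIV T" using lin by (simp add: linear_continuous_on linear_conv_bounded_linear)
  have [measurable]: "T \<in> borel_measurable borel" using cont by (rule borel_measurable_continuous_onI)
  have TA [measurable]: "T -` A \<in> sets borel" using measurable_sets[of T borel borel A] by simp
  have nT: "norm (T x) = norm x" for x using ip[of x x] by (simp add: norm_eq)
  let ?U = "ball (0::'a) 1"
  have [measurable]: "?U \<in> sets borel" by (rule borel_open) simp
  have shift: "(\<integral>\<^sup>+ x. f x \<partial>lborel) = (\<integral>\<^sup>+ x. f (a + x) \<partial>lborel)"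
    if [measurable]: "f \<in> borel_measurable borel" for f :: "'a \<Rightarrow> ennreal" and a
  proof -
    have "(\<integral>\<^sup>+ x. f x \<partial>lborel) = (\<integral>\<^sup>+ x. f x \<partial>distr lborel borel ((+) a))" by (simp add: lborel_distr_plus)
    also have "\<dots> = (\<integral>\<^sup>+ x. f (a + x) \<partial>lborel)" by (subst nn_integral_distr) auto
    finally show ?thesis .
  qed
  have "emeasure lborel ?U * emeasure lborel (T -` A)
      = (\<integral>\<^sup>+ y. indicator ?U y * (\<integral>\<^sup>+ x. indicator (T -` A) x \<partial>lborel) \<partial>lborel)"
    by (subst nn_integral_multc) (auto intro!: borel_measurable_indicator simp: TA)
  also have "\<dots> = (\<integral>\<^sup>+ y. \<integral>\<^sup>+ x. indicator ?U y * indicator A (T x + y) \<partial>lborel \<partial>lborel)"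
  proof (rule nn_integral_cong)
    fix y
    have "(\<integral>\<^sup>+ x. indicator (T -` A) x \<partial>lborel) = (\<integral>\<^sup>+ x. indicator (T -` A) (T y + x) \<partial>lborel)"
      by (rule shift) measurable
    also have "\<dots> = (\<integral>\<^sup>+ x. indicator A (T x + y) \<partial>lborel)"
      using linear_add[OF lin] inv by (intro nn_integral_cong) (simp add: indicator_def add.commute)
    finally show "indicator ?U y * (\<integral>\<^sup>+ x. indicator (T -` A) x \<partial>lborel)
        = (\<integral>\<^sup>+ x. indicator ?U y * indicator A (T x + y) \<partial>lborel)"
      by (simp add: nn_integral_cmult)
  qed
  also have "\<dots> = (\<integral>\<^sup>+ x. \<integral>\<^sup>+ y. indicator ?U y * indicator A (T x + y) \<partial>lborel \<partial>lborel)"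
    by (intro lborel_pair.Fubini') measurable
  also have "\<dots> = (\<integral>\<^sup>+ x. \<integral>\<^sup>+ y. indicator ?U (- T x + y) * indicator A y \<partial>lborel \<partial>lborel)"
  proof (rule nn_integral_cong)
    fix x
    have "(\<integral>\<^sup>+ y. indicator ?U y * indicator A (T x + y) \<partial>lborel)
        = (\<integral>\<^sup>+ y. indicator ?U (- T x + y) * indicator A (T x + (- T x + y)) \<partial>lborel)"
      by (rule shift) measurable
    then show "(\<integral>\<^sup>+ y. indicator ?U y * indicator A (T x + y) \<partial>lborel)
        = (\<integral>\<^sup>+ y. indicator ?U (- T x + y) * indicator A y \<partial>lborel)" by simp
  qed
  also have "\<dots> = (\<integral>\<^sup>+ y. \<integral>\<^sup>+ x. indicator ?U (- T x + y) * indicator A y \<partial>lborel \<partial>lborel)"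
    by (intro lborel_pair.Fubini') measurable
  also have "\<dots> = (\<integral>\<^sup>+ y. emeasure lborel ?U * indicator A y \<partial>lborel)"
  proof (rule nn_integral_cong)
    fix y
    have "indicator ?U (- T x + y) = (indicator (ball (T y) 1) x :: ennreal)" for x
    proof -
      have "norm (- T x + y) = norm (T (T y - x))" using inv linear_diff[OF lin] by simp
      then show ?thesis by (simp add: indicator_def dist_norm nT norm_minus_commute)
    qed
    then have "(\<integral>\<^sup>+ x. indicator ?U (- T x + y) * indicator A y \<partial>lborel)
        = (\<integral>\<^sup>+ x. indicator (ball (T y) 1) x * indicator A y \<partial>lborel)" by simp
    also have "\<dots> = emeasure lborel (ball (T y) 1) * indicator A y"
      by (subst nn_integral_multc) (auto intro!: borel_measurable_indicator)
    finally show "(\<integral>\<^sup>+ x. indicator ?U (- T x + y) * indicator A y \<partial>lborel) = emeasure lborel ?U * indicator A y"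
      by (simp add: emeasure_ball)
  qed
  also have "\<dots> = emeasure lborel ?U * emeasure lborel A"
    by (simp add: nn_integral_cmult)
  finally have eq: "emeasure lborel ?U * emeasure lborel (T -` A) = emeasure lborel ?U * emeasure lborel A" .
  have "emeasure lborel ?U \<noteq> 0" "emeasure lborel ?U \<noteq> top"
    using emeasure_ball_pos[of 1 "0::'a"] emeasure_lborel_ball_finite[of "0::'a" 1] by auto
  with eq show ?thesis by (simp add: ennreal_mult_cancel_left)
qed

lemma polar_set_isometry_vimage:
  assumes inv: "\<And>x. T (T x) = x" and ip: "\<And>x y. T x \<bullet> T y = x \<bullet> y"
  shows "polar_set (T -` A) = T -` polar_set A"
proof -
  have "(\<forall>x. T x \<in> A \<longrightarrow> x \<bullet> y \<le> 1) \<longleftrightarrow> (\<forall>x\<in>A. x \<bullet> T y \<le> 1)" for y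
    using inv ip by metis
  then show ?thesis by (auto simp: polar_set_def)
qed

text \<open>
  Averaging over translations: the integral over \<open>v\<close> of the measure of \<open>U \<inter> (V - v)\<close> is
  \<open>|U| |V|\<close>, and only vectors \<open>v\<close> of norm less than \<open>2R\<close> contribute.
\<close>
lemma exists_large_overlap:
  fixes U V :: "'a::euclidean_space set"
  assumes [measurable]: "U \<in> sets borel" "V \<in> sets borel" and sub: "U \<subseteq> ball 0 R" "V \<subseteq> ball 0 R"
    and c: "c * emeasure lborel (ball (0::'a) (2 * R)) < emeasure lborel U * emeasure lborel V"
  obtains v where "c < emeasure lborel {x. x \<in> U \<and> x + v \<in> V}"
proof (rule ccontr)
  assume "\<not> thesis"
  with that have le: "emeasure lborel {x. x \<in> U \<and> x + v \<in> V} \<le> c" for v by (meson not_le)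
  have "emeasure lborel U * emeasure lborel V = (\<integral>\<^sup>+ x. indicator U x * emeasure lborel V \<partial>lborel)"
    by (simp add: nn_integral_multc)
  also have "\<dots> = (\<integral>\<^sup>+ x. \<integral>\<^sup>+ v. indicator U x * indicator V (x + v) \<partial>lborel \<partial>lborel)"
  proof (rule nn_integral_cong)
    fix x :: 'a
    have "emeasure lborel V = emeasure (distr lborel borel ((+) x)) V" by (simp add: lborel_distr_plus)
    also have "\<dots> = (\<integral>\<^sup>+ v. indicator V v \<partial>distr lborel borel ((+) x))" by simp
    also have "\<dots> = (\<integral>\<^sup>+ v. indicator V (x + v) \<partial>lborel)" by (subst nn_integral_distr) auto
    finally show "indicator U x * emeasure lborel V = (\<integral>\<^sup>+ v. indicator U x * indicator V (x + v) \<partial>lborel)"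
      by (simp add: nn_integral_cmult)
  qed
  also have "\<dots> = (\<integral>\<^sup>+ v. \<integral>\<^sup>+ x. indicator U x * indicator V (x + v) \<partial>lborel \<partial>lborel)"
    by (intro lborel_pair.Fubini') measurable
  also have "\<dots> = (\<integral>\<^sup>+ v. emeasure lborel {x. x \<in> U \<and> x + v \<in> V} \<partial>lborel)"
  proof (rule nn_integral_cong)
    fix v
    have "(\<integral>\<^sup>+ x. indicator U x * indicator V (x + v) \<partial>lborel) = (\<integral>\<^sup>+ x. indicator {x. x \<in> U \<and> x + v \<in> V} x \<partial>lborel)"
      by (intro nn_integral_cong) (auto simp: indicator_def)
    then show "(\<integral>\<^sup>+ x. indicator U x * indicator V (x + v) \<partial>lborel) = emeasure lborel {x. x \<in> U \<and> x + v \<in> V}"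
      by simp
  qed
  also have "\<dots> \<le> (\<integral>\<^sup>+ v. c * indicator (ball (0::'a) (2 * R)) v \<partial>lborel)"
  proof (rule nn_integral_mono)
    fix v :: 'a
    show "emeasure lborel {x. x \<in> U \<and> x + v \<in> V} \<le> c * indicator (ball 0 (2 * R)) v"
    proof (cases "v \<in> ball 0 (2 * R)")
      case False
      have empty: "{x. x \<in> U \<and> x + v \<in> V} = {}"
      proof -
        have False if "x \<in> U" "x + v \<in> V" for x
        proof -
          have "norm x < R" "norm (x + v) < R" using that sub by auto
          moreover have "norm v \<le> norm (x + v) + norm x" using norm_triangle_ineq4[of "x + v" x] by simp
          ultimately show False using False by simp
        qed
        then show ?thesis by blast
      qed
      show ?thesis unfolding empty by simp
    qed (use le in simp)
  qed
  also have "\<dots> = c * emeasure lborel (ball (0::'a) (2 * R))" by (rule nn_integral_cmult_indicator) simp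
  finally show False using c by simp
qed

text \<open>
  The class in which the symmetrization takes place. It records exactly what a Steiner symmetrization
  preserves; in particular the volume of the polar has not decreased relative to the initial set.
\<close>
definition symmetrized :: "real \<Rightarrow> 'a::euclidean_space set \<Rightarrow> 'a set set" where
  "symmetrized R A = {X \<in> sets borel. (\<forall>x. - x \<in> X \<longleftrightarrow> x \<in> X) \<and> X \<subseteq> ball 0 R
     \<and> emeasure lborel X = emeasure lborel A
     \<and> emeasure lborel (polar_set A) \<le> emeasure lborel (polar_set X)}"

text \<open>
  One step of the symmetrization. Since \<open>X\<close> is at least as large as the ball, the part of \<open>X\<close>
  outside the ball is at least as large as the part of the ball outside \<open>X\<close>. Some translation moves
  a definite amount of the former into the latter; a reflection turns its direction into a coordinate
  axis, and symmetrizing along that axis gains this amount of overlap.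
\<close>
lemma symmetrized_improve:
  fixes A X :: "'a::euclidean_space set"
  assumes X: "X \<in> symmetrized R A" and r: "0 < r" "r \<le> R"
    and vol: "emeasure lborel (ball (0::'a) r) \<le> emeasure lborel A"
    and c: "c * emeasure lborel (ball (0::'a) (2 * R)) < (emeasure lborel (ball 0 r - X))\<^sup>2"
  obtains Y where "Y \<in> symmetrized R A"
    "emeasure lborel (X \<inter> ball 0 r) + c \<le> emeasure lborel (Y \<inter> ball 0 r)"
proof -
  let ?B = "ball (0::'a) r"
  have [measurable]: "?B \<in> sets borel" by (rule borel_open) simp
  have X_borel [measurable]: "X \<in> sets borel" and X_sym: "\<And>x. - x \<in> X \<longleftrightarrow> x \<in> X" and X_R: "X \<subseteq> ball 0 R"
    and X_vol: "emeasure lborel X = emeasure lborel A"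
    and X_pol: "emeasure lborel (polar_set A) \<le> emeasure lborel (polar_set X)"
    using X by (auto simp: symmetrized_def)
  have "emeasure lborel (?B \<inter> X) + emeasure lborel (?B - X) = emeasure lborel ?B"
    by (subst plus_emeasure) (auto simp: Int_Diff_Un)
  also have "\<dots> \<le> emeasure lborel X" using vol X_vol by simp
  also have "\<dots> = emeasure lborel (?B \<inter> X) + emeasure lborel (X - ?B)"
    by (subst plus_emeasure) (auto intro!: arg_cong[where f="emeasure lborel"])
  finally have "emeasure lborel (?B \<inter> X) + emeasure lborel (?B - X)
      \<le> emeasure lborel (?B \<inter> X) + emeasure lborel (X - ?B)" .
  moreover have "emeasure lborel (?B \<inter> X) < top"
    using emeasure_mono[of "?B \<inter> X" ?B lborel] emeasure_lborel_ball_finite[of "0::'a" r]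
    by (auto intro: le_less_trans)
  ultimately have le: "emeasure lborel (?B - X) \<le> emeasure lborel (X - ?B)"
    by (auto simp: ennreal_add_left_cancel_le)
  then have "c * emeasure lborel (ball (0::'a) (2 * R)) < emeasure lborel (X - ?B) * emeasure lborel (?B - X)"
    using c mult_right_mono[OF le, of "emeasure lborel (?B - X)"]
    unfolding power2_eq_square by (auto intro: less_le_trans)
  then obtain v where v: "c < emeasure lborel {x. x \<in> X - ?B \<and> x + v \<in> ?B - X}"
    using X_R r by (elim exists_large_overlap[rotated 4]) auto
  obtain e :: 'a where e: "e \<in> Basis" using nonempty_Basis by blast
  obtain T where T: "linear T" "\<And>x. T (T x) = x" "\<And>x y. T x \<bullet> T y = x \<bullet> y" "T v = norm v *\<^sub>R e"
    using reflection_exists[of v "norm v *\<^sub>R e"] norm_Basis[OF e] by auto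
  have nT: "norm (T x) = norm x" for x using T(3)[of x x] by (simp add: norm_eq)
  note meas = emeasure_isometry_vimage[OF T(1-3)]
  have cont: "continuous_on UNIV T" using T(1) by (simp add: linear_continuous_on linear_conv_bounded_linear)
  have [measurable]: "T \<in> borel_measurable borel" using cont by (rule borel_measurable_continuous_onI)
  let ?X = "T -` X"
  have TX [measurable]: "?X \<in> sets borel" using measurable_sets[of T borel borel X] by simp
  have TX_sym: "- x \<in> ?X \<longleftrightarrow> x \<in> ?X" for x using X_sym linear_neg[OF T(1)] by simp
  have TX_R: "?X \<subseteq> ball 0 R" using X_R nT by (auto simp: subset_iff)
  have TB: "T -` ?B = ?B" using nT by auto
  let ?Y = "steiner e ?X"
  have "emeasure lborel (polar_set X) = emeasure lborel (polar_set ?X)"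
    unfolding polar_set_isometry_vimage[OF T(2,3)] by (rule meas[symmetric]) measurable
  also have "\<dots> \<le> emeasure lborel (polar_set ?Y)"
    using e TX_sym by (intro emeasure_polar_set_steiner) auto
  finally have pol: "emeasure lborel (polar_set A) \<le> emeasure lborel (polar_set ?Y)"
    using X_pol by simp
  have Y: "?Y \<in> symmetrized R A"
    unfolding symmetrized_def
    using steiner_uminus[OF TX TX_sym] steiner_subset_ball[OF norm_Basis[OF e] TX_R]
      emeasure_steiner[OF e TX] meas[OF X_borel] X_vol pol
    by auto
  have Tv: "T (x + norm v *\<^sub>R e) = T x + v" for x
    using linear_add[OF T(1)] T(2)[of v] T(4) by simp
  have "norm (T x + v) = norm (x + norm v *\<^sub>R e)" for x
    using nT[of "x + norm v *\<^sub>R e"] by (simp only: Tv)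
  then have "{x. x \<in> ?X - ?B \<and> x + norm v *\<^sub>R e \<in> ?B - ?X} = T -` {x. x \<in> X - ?B \<and> x + v \<in> ?B - X}"
    by (auto simp: Tv nT)
  moreover have "emeasure lborel (T -` {x. x \<in> X - ?B \<and> x + v \<in> ?B - X}) = emeasure lborel {x. x \<in> X - ?B \<and> x + v \<in> ?B - X}"
    by (rule meas) measurable
  moreover have "?X \<inter> ?B = T -` (X \<inter> ?B)" using TB by auto
  moreover have "emeasure lborel (T -` (X \<inter> ?B)) = emeasure lborel (X \<inter> ?B)" by (rule meas) measurable
  ultimately have "emeasure lborel (X \<inter> ?B) + emeasure lborel {x. x \<in> X - ?B \<and> x + v \<in> ?B - X}
      \<le> emeasure lborel (?Y \<inter> ?B)"
    using emeasure_steiner_Int[OF e TX, of ?B "norm v"] steiner_ball[OF norm_Basis[OF e] r(1)] by simp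
  moreover have "emeasure lborel (X \<inter> ?B) + c
      \<le> emeasure lborel (X \<inter> ?B) + emeasure lborel {x. x \<in> X - ?B \<and> x + v \<in> ?B - X}"
    using v by (intro add_left_mono) simp
  ultimately have "emeasure lborel (X \<inter> ?B) + c \<le> emeasure lborel (?Y \<inter> ?B)" by (rule order_trans[rotated])
  with Y show thesis by (rule that)
qed

text \<open>
  As long as a fixed amount \<open>k\<close> of the ball is missing, each step gains a fixed amount \<open>c\<close> of
  overlap. This cannot go on, because the overlap is bounded by the volume of the ball.
\<close>
lemma symmetrized_approaches_ball:
  fixes A :: "'a::euclidean_space set"
  assumes A: "A \<in> sets borel" "\<And>x. - x \<in> A \<longleftrightarrow> x \<in> A" "A \<subseteq> ball 0 R" and r: "0 < r" "r \<le> R"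
    and vol: "emeasure lborel (ball (0::'a) r) \<le> emeasure lborel A" and k: "0 < k"
  obtains X where "X \<in> symmetrized R A" "emeasure lborel (ball 0 r - X) < ennreal k"
proof (rule ccontr)
  assume "\<not> thesis"
  with that have ge: "ennreal k \<le> emeasure lborel (ball 0 r - X)" if "X \<in> symmetrized R A" for X
    using that by (meson not_le)
  let ?W = "unit_ball_vol (DIM('a)) * (2 * R) ^ DIM('a)"
  have W: "0 < ?W" using r by simp
  \<comment> \<open>The gain allowed by averaging is anything below \<open>k\<^sup>2 / |ball (2R)|\<close>; half of that is strictly below.\<close>
  define c where "c = k\<^sup>2 / (2 * ?W)"
  have c: "0 < c" using k W by (simp add: c_def)
  have "c * ?W < k\<^sup>2" using W k by (simp add: c_def field_simps)
  then have "ennreal c * emeasure lborel (ball (0::'a) (2 * R)) < (ennreal k)\<^sup>2"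
    using c W k r by (simp add: emeasure_ball ennreal_mult'[symmetric] ennreal_power ennreal_less_iff)
  then have small: "ennreal c * emeasure lborel (ball (0::'a) (2 * R)) < (emeasure lborel (ball 0 r - X))\<^sup>2"
    if "X \<in> symmetrized R A" for X
    using power_mono[OF ge[OF that], of 2] by (auto intro: less_le_trans)
  have "\<exists>X \<in> symmetrized R A. of_nat n * ennreal c \<le> emeasure lborel (X \<inter> ball 0 r)" for n
  proof (induction n)
    case 0
    have "A \<in> symmetrized R A" using A by (simp add: symmetrized_def)
    then show ?case by auto
  next
    case (Suc n)
    then obtain X where X: "X \<in> symmetrized R A" "of_nat n * ennreal c \<le> emeasure lborel (X \<inter> ball 0 r)" by blast
    from X(1) r vol small[OF X(1)] obtain Y where Y: "Y \<in> symmetrized R A"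
      "emeasure lborel (X \<inter> ball 0 r) + ennreal c \<le> emeasure lborel (Y \<inter> ball 0 r)"
      by (rule symmetrized_improve)
    have "of_nat (Suc n) * ennreal c = of_nat n * ennreal c + ennreal c" by (simp add: distrib_right add.commute)
    also have "\<dots> \<le> emeasure lborel (X \<inter> ball 0 r) + ennreal c" using X(2) by (rule add_right_mono)
    also note Y(2)
    finally show ?case using Y(1) by blast
  qed
  moreover have "emeasure lborel (X \<inter> ball (0::'a) r) \<le> emeasure lborel (ball (0::'a) r)" for X
    by (intro emeasure_mono) auto
  ultimately have "of_nat n * ennreal c \<le> emeasure lborel (ball (0::'a) r)" for n :: nat by (meson order_trans)
  then have le: "real n * c \<le> unit_ball_vol (DIM('a)) * r ^ DIM('a)" for n :: nat
    using r c by (simp add: emeasure_ball ennreal_of_nat_eq_real_of_nat ennreal_mult'[symmetric] ennreal_le_iff)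
  obtain n where "unit_ball_vol (DIM('a)) * r ^ DIM('a) < real n * c"
    using c reals_Archimedean3 by blast
  with le[of n] show False by simp
qed

text \<open>
  A point \<open>y\<close> far out cuts off from the ball a cap whose volume is bounded below independently of
  \<open>y\<close>; hence a set that misses very little of the ball has its polar in a slightly larger ball than
  the polar of the ball.
\<close>
lemma halfspace_cap_contains_ball:
  fixes y :: "'a::euclidean_space"
  assumes "0 < \<rho>" "\<rho> < r" "1 / \<rho> < norm y"
  obtains c where "ball c ((r - \<rho>) / 2) \<subseteq> {x \<in> ball 0 r. 1 < x \<bullet> y}"
proof
  define h where "h = (r - \<rho>) / 2"
  \<comment> \<open>The ball of diameter \<open>r - \<rho>\<close> in direction \<open>y\<close> that fills the gap between the radii \<open>\<rho>\<close> and \<open>r\<close>.\<close>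
  define c where "c = ((r + \<rho>) / 2 / norm y) *\<^sub>R y"
  have "0 < 1 / \<rho>" using assms by simp
  then have ny: "0 < norm y" using assms(3) by linarith
  have norm_c: "norm c = (r + \<rho>) / 2" using ny assms by (simp add: c_def)
  have c_y: "c \<bullet> y = (r + \<rho>) / 2 * norm y"
    using ny by (simp add: c_def power2_norm_eq_inner[symmetric] power2_eq_square)
  show "ball c ((r - \<rho>) / 2) \<subseteq> {x \<in> ball 0 r. 1 < x \<bullet> y}"
  proof
    fix x assume "x \<in> ball c ((r - \<rho>) / 2)"
    then have w: "norm (x - c) < h" by (simp add: dist_norm norm_minus_commute h_def)
    have "norm x \<le> norm c + norm (x - c)" using norm_triangle_sub by (metis add.commute)
    then have "norm x < r" using w norm_c by (simp add: h_def field_simps)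
    have "- ((x - c) \<bullet> y) \<le> norm (x - c) * norm y"
      using Cauchy_Schwarz_ineq2[of "x - c" y] by linarith
    also have "\<dots> \<le> h * norm y" using w ny by (intro mult_right_mono) auto
    finally have "c \<bullet> y - h * norm y \<le> x \<bullet> y" by (simp add: inner_diff_left)
    moreover have "c \<bullet> y - h * norm y = \<rho> * norm y"
      unfolding c_y h_def by (simp add: field_simps)
    moreover have "1 < \<rho> * norm y" using assms by (simp add: field_simps)
    ultimately show "x \<in> {x \<in> ball 0 r. 1 < x \<bullet> y}" using \<open>norm x < r\<close> by simp
  qed
qed

lemma santalo_bounded:
  fixes A :: "'a::euclidean_space set"
  assumes A: "A \<in> sets borel" "\<And>x. - x \<in> A \<longleftrightarrow> x \<in> A" "A \<subseteq> ball 0 R" and r: "0 < \<rho>" "\<rho> < r"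
    and vol: "emeasure lborel (ball (0::'a) r) \<le> emeasure lborel A"
  shows "emeasure lborel (polar_set A) \<le> emeasure lborel (cball (0::'a) (1 / \<rho>))"
proof -
  define k where "k = unit_ball_vol (DIM('a)) * ((r - \<rho>) / 2) ^ DIM('a)"
  have k: "0 < k" using r by (simp add: k_def)
  obtain X where X: "X \<in> symmetrized (max R r) A" "emeasure lborel (ball 0 r - X) < ennreal k"
    using A r vol k by (elim symmetrized_approaches_ball[of A "max R r" r k, rotated 7]) auto
  have [measurable]: "X \<in> sets borel" using X by (simp add: symmetrized_def)
  have "polar_set X \<subseteq> cball 0 (1 / \<rho>)"
  proof
    fix y assume y: "y \<in> polar_set X"
    show "y \<in> cball 0 (1 / \<rho>)"
    proof (rule ccontr)
      assume "y \<notin> cball 0 (1 / \<rho>)"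
      then have "1 / \<rho> < norm y" by simp
      with r obtain c where c: "ball c ((r - \<rho>) / 2) \<subseteq> {x \<in> ball 0 r. 1 < x \<bullet> y}"
        by (rule halfspace_cap_contains_ball)
      also have "\<dots> \<subseteq> ball 0 r - X" using y by (force simp: polar_set_def)
      finally have "emeasure lborel (ball c ((r - \<rho>) / 2)) \<le> emeasure lborel (ball 0 r - X)"
        by (intro emeasure_mono) auto
      with X(2) show False using r by (simp add: emeasure_ball k_def)
    qed
  qed
  then have "emeasure lborel (polar_set X) \<le> emeasure lborel (cball (0::'a) (1 / \<rho>))"
    by (intro emeasure_mono) auto
  moreover have "emeasure lborel (polar_set A) \<le> emeasure lborel (polar_set X)"
    using X(1) by (simp add: symmetrized_def)
  ultimately show ?thesis by (rule order_trans[rotated])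
qed

text \<open>
  The Blaschke--Santalo inequality for symmetric Borel sets: the polar of \<open>A\<close> is at most as large as the
  polar of a centred ball that is at most as large as \<open>A\<close>. Truncation to bounded sets and the strict
  inequality between the radii are removed by letting \<open>\<rho>\<close> increase to \<open>r\<close>.
\<close>
theorem blaschke_santalo:
  fixes A :: "'a::euclidean_space set"
  assumes A [measurable]: "A \<in> sets borel" and sym: "\<And>x. - x \<in> A \<longleftrightarrow> x \<in> A" and r: "0 < r"
    and vol: "emeasure lborel (ball (0::'a) r) \<le> emeasure lborel A"
  shows "emeasure lborel (polar_set A) \<le> emeasure lborel (cball (0::'a) (1 / r))"
proof -
  have le: "emeasure lborel (polar_set A) \<le> emeasure lborel (cball (0::'a) (1 / \<rho>))" if \<rho>: "0 < \<rho>" "\<rho> < r" for \<rho>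
  proof -
    define \<sigma> where "\<sigma> = (\<rho> + r) / 2"
    have \<sigma>: "\<rho> < \<sigma>" "\<sigma> < r" "0 < \<sigma>" using \<rho> by (auto simp: \<sigma>_def)
    have "(\<Union>n. A \<inter> ball 0 (real n)) = A"
      using reals_Archimedean2 by auto
    then have lim: "(\<lambda>n. emeasure lborel (A \<inter> ball 0 (real n))) \<longlonglongrightarrow> emeasure lborel A"
      using Lim_emeasure_incseq[of "\<lambda>n. A \<inter> ball 0 (real n)" lborel] by (force simp: incseq_def)
    have "emeasure lborel (ball (0::'a) \<sigma>) < emeasure lborel (ball (0::'a) r)"
      using \<sigma> r by (simp add: emeasure_ball ennreal_less_iff power_strict_mono)
    also note vol
    finally have "emeasure lborel (ball (0::'a) \<sigma>) < emeasure lborel A" .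
    from order_tendstoD(1)[OF lim this] obtain n :: nat
      where "emeasure lborel (ball (0::'a) \<sigma>) < emeasure lborel (A \<inter> ball 0 (real n))"
      by (auto simp: eventually_sequentially)
    then have "emeasure lborel (polar_set (A \<inter> ball 0 (real n))) \<le> emeasure lborel (cball (0::'a) (1 / \<rho>))"
      using sym \<rho> \<sigma> by (intro santalo_bounded[of _ "real n" \<rho> \<sigma>]) auto
    moreover have "emeasure lborel (polar_set A) \<le> emeasure lborel (polar_set (A \<inter> ball 0 (real n)))"
      by (intro emeasure_mono polar_set_antimono) auto
    ultimately show ?thesis by (rule order_trans[rotated])
  qed
  let ?v = "\<lambda>\<rho>. unit_ball_vol (DIM('a)) * (1 / \<rho>) ^ DIM('a)"
  have "((\<lambda>\<rho>. ennreal (?v \<rho>)) \<longlongrightarrow> ennreal (?v r)) (at_left r)"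
    using r by (intro tendsto_ennrealI tendsto_intros) auto
  moreover have "\<forall>\<^sub>F \<rho> in at_left r. emeasure lborel (polar_set A) \<le> ennreal (?v \<rho>)"
    using eventually_at_left_real[OF r]
  proof eventually_elim
    case (elim \<rho>)
    then show ?case using le[of \<rho>] by (simp add: emeasure_cball)
  qed
  ultimately have "emeasure lborel (polar_set A) \<le> ennreal (?v r)"
    by (intro tendsto_lowerbound) auto
  then show ?thesis using r by (simp add: emeasure_cball)
qed


section \<open>Polar transforms and rearrangement\<close>

lemma convex_ray_lower_bound:
  fixes f :: "'a::real_vector \<Rightarrow> real"
  assumes conv: "convex_on UNIV f" and f0: "f 0 = 0" and s: "1 \<le> s"
  shows "s * f y \<le> f (s *\<^sub>R y)"
proof -
  have "f ((1 - 1 / s) *\<^sub>R 0 + (1 / s) *\<^sub>R (s *\<^sub>R y)) \<le> (1 - 1 / s) * f 0 + (1 / s) * f (s *\<^sub>R y)"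
    using s by (intro convex_onD[OF conv]) auto
  then show ?thesis using s f0 by (simp add: field_simps)
qed

text \<open>
  Evaluate the supremum far out on a ray on which \<open>f\<close> is positive and \<open>x\<close> has nonnegative inner
  product: the quotient is at least \<open>- 1 / f\<close>, and \<open>f\<close> tends to infinity along the ray by convexity.
  By evenness such a ray exists.
\<close>
lemma polar_nonneg:
  fixes f :: "'a::euclidean_space \<Rightarrow> real"
  assumes f: "f \<in> Cvx0"
  shows "0 \<le> polar f x"
proof (cases "f = (\<lambda>_. 0)")
  case False
  have conv: "convex_on UNIV f" and nn: "\<And>x. 0 \<le> f x" and even: "\<And>x. f (- x) = f x" and f0: "f 0 = 0"
    using f by (auto simp: Cvx0_def)
  obtain y0 where "f y0 \<noteq> 0" using False by auto
  then obtain y where y: "0 < f y" "0 \<le> x \<bullet> y"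
    using nn[of y0] even[of y0] by (cases "0 \<le> x \<bullet> y0") (auto simp: less_le intro: that[of y0] that[of "- y0"])
  have bound: "ereal (- (1 / (real (Suc n) * f y))) \<le> polar f x" for n
  proof -
    let ?s = "real (Suc n)"
    have le: "?s * f y \<le> f (?s *\<^sub>R y)"
      using conv f0 by (rule convex_ray_lower_bound) simp
    have pos: "0 < ?s * f y" using y by simp
    then have fpos: "0 < f (?s *\<^sub>R y)" using le by linarith
    have "- (1 / (?s * f y)) \<le> - (1 / f (?s *\<^sub>R y))"
      using le pos by (simp add: frac_le del: of_nat_Suc)
    also have "\<dots> = (- 1) / f (?s *\<^sub>R y)" by simp
    also have "\<dots> \<le> (x \<bullet> (?s *\<^sub>R y) - 1) / f (?s *\<^sub>R y)"
      using y fpos by (intro divide_right_mono) auto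
    finally have "ereal (- (1 / (?s * f y))) \<le> ereal ((x \<bullet> (?s *\<^sub>R y) - 1) / f (?s *\<^sub>R y))" by simp
    also have "\<dots> = ereal (x \<bullet> (?s *\<^sub>R y) - 1) / ereal (f (?s *\<^sub>R y))" using fpos by simp
    also have "\<dots> \<le> polar f x" unfolding polar_def if_not_P[OF False] by (rule SUP_upper) (rule UNIV_I)
    finally show ?thesis .
  qed
  have "(\<lambda>n. - (1 / (real (Suc n) * f y))) \<longlonglongrightarrow> - 0"
    using LIMSEQ_Suc[OF lim_1_over_n] y
    by (intro tendsto_minus) (auto intro!: tendsto_eq_intros simp: divide_inverse inverse_mult_distrib)
  then have "(\<lambda>n. ereal (- (1 / (real (Suc n) * f y)))) \<longlonglongrightarrow> ereal (- 0)"
    by (rule tendsto_ereal)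
  then have "ereal (- 0) \<le> polar f x"
    by (rule LIMSEQ_le_const2) (blast intro: bound)
  then show ?thesis by (simp add: zero_ereal_def)
qed (simp add: polar_def)

text \<open>
  The conventions for division by zero make this uniform: where \<open>g y = 0\<close>, the quotient is at most
  \<open>t\<close> exactly when its numerator is at most zero.
\<close>
lemma polar_le_iff:
  fixes g :: "'a::euclidean_space \<Rightarrow> real"
  assumes g: "g \<noteq> (\<lambda>_. 0)" and nn: "\<And>y. 0 \<le> g y" and t: "0 \<le> t"
  shows "polar g x \<le> ereal t \<longleftrightarrow> (\<forall>y. x \<bullet> y \<le> 1 + t * g y)"
proof -
  have "ereal (x \<bullet> y - 1) / ereal (g y) \<le> ereal t \<longleftrightarrow> x \<bullet> y \<le> 1 + t * g y" for y
  proof (cases "g y = 0")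
    case True
    then show ?thesis
      using ereal_quotient_conventions(1) ereal_quotient_conventions(2,3)[of "x \<bullet> y - 1"] t
      by (cases "x \<bullet> y - 1" "0::real" rule: linorder_cases) (auto simp: zero_ereal_def)
  next
    case False
    then have "0 < g y" using nn[of y] by simp
    then show ?thesis using False by (simp add: pos_divide_le_eq) linarith
  qed
  then show ?thesis unfolding polar_def if_not_P[OF g] by (simp only: SUP_le_iff ball_UNIV)
qed

lemma set_rearr_mono:
  fixes A B :: "'a::euclidean_space set"
  assumes le: "emeasure lebesgue A \<le> emeasure lebesgue B"
  shows "set_rearr A \<subseteq> set_rearr B"
proof (cases "emeasure lebesgue B = \<infinity>")
  case True
  then show ?thesis by (simp add: set_rearr_def)
next
  case False
  then have fin: "emeasure lebesgue A \<noteq> \<infinity>" using le by (auto simp: top_unique)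
  obtain r where r: "0 \<le> r" "set_rearr A = ball 0 r" "emeasure lebesgue (ball (0::'a) r) = emeasure lebesgue A"
    using fin by (rule set_rearr_ball)
  obtain q where q: "0 \<le> q" "set_rearr B = ball 0 q" "emeasure lebesgue (ball (0::'a) q) = emeasure lebesgue B"
    using False by (rule set_rearr_ball)
  have "r ^ DIM('a) \<le> q ^ DIM('a)"
    using le unfolding r(3)[symmetric] q(3)[symmetric]
    using r(1) q(1) by (simp add: emeasure_ball ennreal_le_iff)
  then have "r \<le> q" using r(1) q(1) by (simp add: power_mono_iff)
  then show ?thesis unfolding r(2) q(2) by (rule subset_ball)
qed

text \<open>
  If \<open>y\<close> lies outside the ball for level \<open>s\<close>, it lies outside all smaller balls, so only the levels
  of \<open>exp (- f)\<close> below \<open>exp (- s)\<close> contribute to the rearrangement at \<open>y\<close>.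
\<close>
lemma incr_rearr_ge:
  fixes f :: "'a::euclidean_space \<Rightarrow> real"
  assumes f: "f \<in> Cvx0" and y: "y \<notin> set_rearr {x. f x < s}"
  shows "s \<le> incr_rearr f y"
proof -
  have cont: "continuous_on UNIV f"
    using f by (intro convex_on_continuous) (auto simp: Cvx0_def)
  have mono: "y \<notin> set_rearr {x. \<sigma> < exp (- f x)}" if \<sigma>: "exp (- s) \<le> \<sigma>" for \<sigma>
  proof
    assume "y \<in> set_rearr {x. \<sigma> < exp (- f x)}"
    moreover have "{x. \<sigma> < exp (- f x)} \<subseteq> {x. f x < s}"
    proof
      fix x assume "x \<in> {x. \<sigma> < exp (- f x)}"
      with \<sigma> have "exp (- s) < exp (- f x)" by (metis le_less_trans mem_Collect_eq)
      then show "x \<in> {x. f x < s}" by simp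
    qed
    then have "emeasure lebesgue {x. \<sigma> < exp (- f x)} \<le> emeasure lebesgue {x. f x < s}"
    proof (rule emeasure_mono)
      have "open {x. f x < s}" using cont by (intro open_Collect_less) auto
      then show "{x. f x < s} \<in> sets lebesgue" by (simp add: borel_open)
    qed
    then have "set_rearr {x. \<sigma> < exp (- f x)} \<subseteq> set_rearr {x. f x < s}" by (rule set_rearr_mono)
    ultimately show False using y by blast
  qed
  have "decr_rearr (\<lambda>x. exp (- f x)) y \<le> (\<integral>\<^sup>+ \<sigma>. indicator {0..exp (- s)} \<sigma> \<partial>lborel)"
    unfolding decr_rearr_def
    using mono by (intro nn_integral_mono) (auto simp: indicator_def not_le)
  also have "\<dots> = ennreal (exp (- s))" by simp
  finally have "enn2real (decr_rearr (\<lambda>x. exp (- f x)) y) \<le> exp (- s)"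
    by (simp add: enn2real_leI)
  moreover have "0 < enn2real (decr_rearr (\<lambda>x. exp (- f x)) y)"
    using decr_rearr_exp_bounds[OF f, of y] by (simp add: enn2real_positive_iff le_less_trans)
  ultimately have "ln (enn2real (decr_rearr (\<lambda>x. exp (- f x)) y)) \<le> - s"
    by (metis ln_exp ln_le_cancel_iff exp_gt_zero)
  then show ?thesis by (simp add: incr_rearr_def)
qed

lemma set_rearr_emeasure_ball:
  fixes A :: "'a::euclidean_space set"
  assumes "y \<in> set_rearr A"
  shows "emeasure lebesgue (ball (0::'a) (norm y)) \<le> emeasure lebesgue A"
proof (cases "emeasure lebesgue A = \<infinity>")
  case False
  then obtain r where r: "set_rearr A = ball 0 r" "emeasure lebesgue (ball (0::'a) r) = emeasure lebesgue A"
    by (rule set_rearr_ball)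
  have "norm y \<le> r" using assms unfolding r(1) by simp
  then have "ball (0::'a) (norm y) \<subseteq> ball 0 r" by (rule subset_ball)
  then have "emeasure lebesgue (ball (0::'a) (norm y)) \<le> emeasure lebesgue (ball (0::'a) r)"
    by (rule emeasure_mono) simp
  with r(2) show ?thesis by (simp only:)
qed simp

lemma incr_rearr_nonneg:
  assumes "f \<in> Cvx0"
  shows "0 \<le> incr_rearr f y"
proof -
  have "{x. f x < 0} = {}" using assms by (auto simp: Cvx0_def not_less)
  then show ?thesis using assms by (intro incr_rearr_ge) auto
qed

lemma incr_rearr_zero: "incr_rearr (\<lambda>_. 0) = (\<lambda>_::'a::euclidean_space. 0)"
proof
  fix y :: 'a
  have "set_rearr {x::'a. s < exp (- 0)} = (if s < 1 then UNIV else {})" for s :: real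
    by (auto simp: set_rearr_def[of UNIV])
  then have "decr_rearr (\<lambda>x::'a. exp (- 0)) y = (\<integral>\<^sup>+ s. indicator {0..<1::real} s \<partial>lborel)"
    unfolding decr_rearr_def by (intro nn_integral_cong) (auto simp: indicator_def)
  also have "\<dots> = 1" by simp
  finally show "incr_rearr (\<lambda>_. 0) y = 0" by (simp add: incr_rearr_def)
qed

text \<open>
  For \<open>y\<close> in the sublevel set \<open>K = {f < s}\<close> the condition \<open>polar f(x) \<le> t\<close> implies
  \<open>x \<bullet> y \<le> 1 + t s\<close>. So the sublevel set of the polar transform lies in the dilate of the polar of
  \<open>K\<close> by \<open>1 + t s\<close>, to which the Blaschke--Santalo inequality applies.
\<close>
lemma polar_sublevel_volume_le:
  fixes f :: "'a::euclidean_space \<Rightarrow> real"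
  assumes f: "f \<in> Cvx0" "f \<noteq> (\<lambda>_. 0)" and t: "0 \<le> t" and s: "0 \<le> s"
    and r: "0 < r" "emeasure lebesgue (ball (0::'a) r) \<le> emeasure lebesgue {x. f x < s}"
  shows "emeasure lebesgue {x. polar f x \<le> ereal t} \<le> emeasure lborel (cball (0::'a) ((1 + t * s) / r))"
proof -
  let ?K = "{x. f x < s}" and ?m = "1 + t * s"
  have conv: "convex_on UNIV f" and nn: "\<And>x. 0 \<le> f x" and even: "\<And>x. f (- x) = f x"
    using f by (auto simp: Cvx0_def)
  have m: "0 < ?m" using t s by (simp add: add_pos_nonneg)
  have cont: "continuous_on UNIV f" using conv by (intro convex_on_continuous) auto
  have K: "?K \<in> sets borel" using cont by (intro borel_open open_Collect_less) auto
  have "{x. polar f x \<le> ereal t} \<subseteq> (\<lambda>x. 0 + ?m *\<^sub>R x) ` polar_set ?K"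
  proof
    fix x assume "x \<in> {x. polar f x \<le> ereal t}"
    then have x: "x \<bullet> y \<le> 1 + t * f y" for y using polar_le_iff[OF f(2) nn t] by auto
    have "(1 / ?m) *\<^sub>R x \<in> polar_set ?K"
      unfolding polar_set_def
    proof (intro CollectI ballI)
      fix y assume "y \<in> ?K"
      then have "t * f y \<le> t * s" using t by (intro mult_left_mono) auto
      then have "x \<bullet> y \<le> ?m" using x[of y] by linarith
      then show "y \<bullet> ((1 / ?m) *\<^sub>R x) \<le> 1" using m by (simp add: inner_commute)
    qed
    then show "x \<in> (\<lambda>x. 0 + ?m *\<^sub>R x) ` polar_set ?K"
      using m by (intro image_eqI[of _ _ "(1 / ?m) *\<^sub>R x"]) auto
  qed
  moreover have "(\<lambda>x. 0 + ?m *\<^sub>R x) ` polar_set ?K \<in> sets lebesgue"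
  proof -
    have "closed ((\<lambda>x. 0 + ?m *\<^sub>R x) ` polar_set ?K)"
      using closed_scaling[OF closed_polar_set, of ?m ?K] by simp
    then show ?thesis by (simp add: borel_closed)
  qed
  ultimately have "emeasure lebesgue {x. polar f x \<le> ereal t} \<le> emeasure lebesgue ((\<lambda>x. 0 + ?m *\<^sub>R x) ` polar_set ?K)"
    by (rule emeasure_mono)
  also have "\<dots> = ennreal (\<bar>?m\<bar> ^ DIM('a)) * emeasure lborel (polar_set ?K)"
    using emeasure_lebesgue_affine[of ?m 0 "polar_set ?K"] by simp
  also have "\<dots> \<le> ennreal (\<bar>?m\<bar> ^ DIM('a)) * emeasure lborel (cball (0::'a) (1 / r))"
    using K even r by (intro mult_left_mono blaschke_santalo) auto
  also have "\<dots> = emeasure lborel (cball (0::'a) (?m / r))"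
    using m r by (simp add: emeasure_cball ennreal_mult'[symmetric] power_divide mult_ac)
  finally show ?thesis .
qed

text \<open>
  Test balls of volume strictly below \<open>p\<close> suffice. The strictness means that the inclusion can be
  proved by contradiction, by bounding \<open>p\<close> by the volume of the test ball.
\<close>
lemma emeasure_le_of_balls_subset:
  fixes S :: "'a::euclidean_space set"
  assumes S: "\<And>q. 0 < q \<Longrightarrow> emeasure lborel (cball (0::'a) q) < p \<Longrightarrow> ball 0 q \<subseteq> S"
    and meas: "S \<in> sets lebesgue"
  shows "p \<le> emeasure lebesgue S"
proof (rule ccontr)
  assume "\<not> ?thesis"
  then have less: "emeasure lebesgue S < p" by simp
  then obtain m where m: "emeasure lebesgue S < m" "m < p" using dense by blast
  then have "m \<noteq> \<infinity>" by auto
  from ball_radius_unique[OF this, where 'a='a] obtain q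
    where q: "0 \<le> q" "emeasure lebesgue (ball (0::'a) q) = m" by blast
  have "q \<noteq> 0" using q(2) m(1) by auto
  then have "ball 0 q \<subseteq> S"
    using q m by (intro S) (simp_all add: emeasure_cball emeasure_ball)
  from emeasure_mono[OF this meas] q(2) m(1) show False by simp
qed

text \<open>
  A ball of radius \<open>q\<close> smaller in volume than \<open>{polar f \<le> t}\<close> lies in \<open>{polar f\<^sub>* \<le> t}\<close>: a violation
  at \<open>x\<close> and \<open>y\<close> would yield a level \<open>s\<close> above the rearrangement at \<open>y\<close> with
  \<open>1 + t s \<le> |y| q\<close>. Then \<open>{f < s}\<close> has at least the volume of the ball of radius \<open>|y|\<close>, and
  \<open>polar_sublevel_volume_le\<close> makes \<open>{polar f \<le> t}\<close> too small. For \<open>t < 0\<close> the left-hand set is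
  empty; for \<open>t \<ge> 0\<close> and a vanishing rearrangement the right-hand set is the whole space.
\<close>
theorem theorem4p5:
  fixes f :: "real ^ 'n \<Rightarrow> real" and t :: real
  assumes "f \<in> Cvx0"
  shows "emeasure lebesgue {x. polar f x \<le> ereal t}
           \<le> emeasure lebesgue {x. polar (incr_rearr f) x \<le> ereal t}"
proof -
  let ?g = "incr_rearr f"
  note g_nn = incr_rearr_nonneg[OF assms]
  consider "t < 0" | "0 \<le> t" "?g = (\<lambda>_. 0)" | "0 \<le> t" "?g \<noteq> (\<lambda>_. 0)" by linarith
  then show ?thesis
  proof cases
    case 1
    then have "ereal t < 0" by simp
    then have "ereal t < polar f x" for x using polar_nonneg[OF assms] by (rule less_le_trans)
    then have "{x. polar f x \<le> ereal t} = {}" using leD by blast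
    then show ?thesis by (simp only: emeasure_empty zero_le)
  next
    case 2
    then have "{x. polar ?g x \<le> ereal t} = UNIV" by (simp add: polar_def)
    then show ?thesis by (simp add: emeasure_lborel_UNIV)
  next
    case 3
    then have f0: "f \<noteq> (\<lambda>_. 0)" using incr_rearr_zero by metis
    have set_eq: "{x. polar ?g x \<le> ereal t} = (\<Inter>y. {x. y \<bullet> x \<le> 1 + t * ?g y})"
      using polar_le_iff[OF 3(2) g_nn 3(1)] by (auto simp: inner_commute)
    show ?thesis
    proof (rule emeasure_le_of_balls_subset)
      show "{x. polar ?g x \<le> ereal t} \<in> sets lebesgue"
      proof -
        have "closed {x. polar ?g x \<le> ereal t}"
          unfolding set_eq by (intro closed_INT ballI closed_halfspace_le)
        then show ?thesis by (simp add: borel_closed)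
      qed
      fix q :: real
      assume q: "0 < q" and vol: "emeasure lborel (cball (0::real^'n) q) < emeasure lebesgue {x. polar f x \<le> ereal t}"
      show "ball 0 q \<subseteq> {x. polar ?g x \<le> ereal t}"
      proof (rule ccontr)
        assume "\<not> ?thesis"
        then obtain x y where xy: "norm x < q" "1 + t * ?g y < y \<bullet> x"
          unfolding set_eq by (auto simp: not_le subset_iff)
        have "y \<bullet> x \<le> norm y * norm x" by (rule norm_cauchy_schwarz)
        also have "\<dots> \<le> norm y * q" using xy by (intro mult_left_mono) auto
        finally have lt: "1 + t * ?g y < norm y * q" using xy by simp
        have "0 < 1 + t * ?g y" using 3(1) g_nn[of y] by (simp add: add_pos_nonneg)
        with lt have ny: "0 < norm y" by auto
        \<comment> \<open>A level above \<open>?g y\<close>, so that \<open>y\<close> enters the rearranged sublevel set, but with \<open>1 + t s\<close>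
            still at most \<open>|y| q\<close>; the denominator covers \<open>t = 0\<close> as well.\<close>
        define s where "s = ?g y + (norm y * q - (1 + t * ?g y)) / (1 + t)"
        have pos: "0 < (norm y * q - (1 + t * ?g y)) / (1 + t)" using lt 3(1) by simp
        then have s: "?g y < s" "0 \<le> s" using g_nn[of y] by (auto simp: s_def)
        have "t * s = t * ?g y + t / (1 + t) * (norm y * q - (1 + t * ?g y))"
          by (simp add: s_def distrib_left)
        also have "\<dots> \<le> t * ?g y + 1 * (norm y * q - (1 + t * ?g y))"
          using lt 3(1) by (intro add_left_mono mult_right_mono) auto
        finally have ts: "1 + t * s \<le> norm y * q" by simp
        have "y \<in> set_rearr {x. f x < s}" using incr_rearr_ge[OF assms, of y s] s by force
        then have "emeasure lebesgue (ball (0::real^'n) (norm y)) \<le> emeasure lebesgue {x. f x < s}"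
          by (rule set_rearr_emeasure_ball)
        then have "emeasure lebesgue {x. polar f x \<le> ereal t}
            \<le> emeasure lborel (cball (0::real^'n) ((1 + t * s) / norm y))"
          by (rule polar_sublevel_volume_le[OF assms f0 3(1) s(2) ny])
        also have "\<dots> \<le> emeasure lborel (cball (0::real^'n) q)"
          using ts ny by (intro emeasure_mono subset_cball) (auto simp: field_simps)
        finally show False using vol by simp
      qed
    qed
  qed
qed

end
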